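(* We have $\mathcal U=\mathcal U^+_q$; that is, there is an algebra isomorphism $\mathcal U^+_q\to\mathcal U$ that sends each of the generators $W_{-k}$, $W_{k+1}$, $G_{k+1}$, $\tilde G_{k+1}$ $(k\in\mathbb N)$ of $\mathcal U^+_q$ to the element of $\mathcal U$ with the same name.
   Context: Conventions: $\mathbb N=\{0,1,2,\ldots\}$; $\mathbb F$ is a field; $q\in\mathbb F$ is nonzero and not a root of unity. All algebras are associative, over $\mathbb F$, with a multiplicative identity. For elements $X,Y$ of an algebra, $\lbrack X,Y\rbrack=XY-YX$, $\lbrack X,Y\rbrack_q=qXY-q^{-1}YX$, and $\lbrack X,Y\rbrack_{q^{-1}}=q^{-1}XY-qYX$. The algebra $\mathcal U$ is defined by generators $W_0$, $W_1$, $\lbrace\tilde G_{k+1}\rbrace_{k\in\mathbb N}$ and relations: (i) $\lbrack W_0,\lbrack W_0,\lbrack W_0,W_1\rbrack_q\rbrack_{q^{-1}}\rbrack=0$; (ii) $\lbrack W_1,\lbrack W_1,\lbrack W_1,W_0\rbrack_q\rbrack_{q^{-1}}\rbrack=0$; (iii) $\lbrack\tilde G_1,W_1\rbrack=q\,\dfrac{\lbrack\lbrack W_0,W_1\rbrack_q,W_1\rbrack}{q^2-q^{-2}}$; (iv) $\lbrack W_0,\tilde G_1\rbrack=q\,\dfrac{\lbrack W_0,\lbrack W_0,W_1\rbrack_q\rbrack}{q^2-q^{-2}}$; (v) for $k\ge1$, $\lbrack\tilde G_{k+1},W_1\rbrack=\dfrac{\lbrack\lbrack\lbrack\tilde G_k,W_0\rbrack_q,W_1\rbrack_q,W_1\rbrack}{(1-q^{-2})(q^2-q^{-2})}$;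 (vi) for $k\ge1$, $\lbrack W_0,\tilde G_{k+1}\rbrack=\dfrac{\lbrack W_0,\lbrack W_0,\lbrack W_1,\tilde G_k\rbrack_q\rbrack_q\rbrack}{(1-q^{-2})(q^2-q^{-2})}$; (vii) for $k,\ell\in\mathbb N$, $\lbrack\tilde G_{k+1},\tilde G_{\ell+1}\rbrack=0$. Put $\tilde G_0=1$. In $\mathcal U$ define, for $k\in\mathbb N$, $$W_{-k}=\frac{\lbrack\tilde G_k,W_0\rbrack_q}{q-q^{-1}},\qquad W_{k+1}=\frac{\lbrack W_1,\tilde G_k\rbrack_q}{q-q^{-1}},\qquad G_{k+1}=\tilde G_{k+1}+\frac{\lbrack W_1,W_{-k}\rbrack}{1-q^{-2}},$$ and $G_0=1$ (for $k=0$ the first two formulas return the generators $W_0,W_1$). The algebra $\mathcal U^+_q$ (the alternating central extension of the positive part of $U_q(\widehat{\mathfrak{sl}}_2)$) is defined by generators $\lbrace W_{-k}\rbrace_{k\in\mathbb N}$, $\lbrace W_{k+1}\rbrace_{k\in\mathbb N}$, $\lbrace G_{k+1}\rbrace_{k\in\mathbb N}$, $\lbrace\tilde G_{k+1}\rbrace_{k\in\mathbb N}$ and the following relations for all $k,\ell\in\mathbb N$: \begin{align*} &\lbrack W_0,W_{k+1}\rbrack=\lbrack W_{-k},W_1\rbrack=(1-q^{-2})(\tilde G_{k+1}-G_{k+1}),\\ &\lbrack W_0,G_{k+1}\rbrack_q=\lbrack \tilde G_{k+1},W_0\rbrack_q=(q-q^{-1})W_{-k-1},\\ &\lbrack G_{k+1},W_1\rbrack_q=\lbrack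 W_1,\tilde G_{k+1}\rbrack_q=(q-q^{-1})W_{k+2},\\ &\lbrack W_{-k},W_{-\ell}\rbrack=0,\qquad \lbrack W_{k+1},W_{\ell+1}\rbrack=0,\\ &\lbrack W_{-k},W_{\ell+1}\rbrack+\lbrack W_{k+1},W_{-\ell}\rbrack=0,\\ &\lbrack W_{-k},G_{\ell+1}\rbrack+\lbrack G_{k+1},W_{-\ell}\rbrack=0,\\ &\lbrack W_{-k},\tilde G_{\ell+1}\rbrack+\lbrack \tilde G_{k+1},W_{-\ell}\rbrack=0,\\ &\lbrack W_{k+1},G_{\ell+1}\rbrack+\lbrack G_{k+1},W_{\ell+1}\rbrack=0,\\ &\lbrack W_{k+1},\tilde G_{\ell+1}\rbrack+\lbrack \tilde G_{k+1},W_{\ell+1}\rbrack=0,\\ &\lbrack G_{k+1},G_{\ell+1}\rbrack=0,\qquad \lbrack \tilde G_{k+1},\tilde G_{\ell+1}\rbrack=0,\\ &\lbrack \tilde G_{k+1},G_{\ell+1}\rbrack+\lbrack G_{k+1},\tilde G_{\ell+1}\rbrack=0. \end{align*} *)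

theory Defs
  imports "HOL-Library.Poly_Mapping" "HOL-Algebra.QuotRing" "HOL-Algebra.Module"
begin

section \<open>Algebras given by generators and relations\<close>

text \<open>
  The free monoid on \<open>'g\<close>, written additively only because the convolution product of
  \<^typ>\<open>'a \<Rightarrow>\<^sub>0 'b\<close> is built from \<open>+\<close> on \<open>'a\<close>.  With this, \<open>'g word \<Rightarrow>\<^sub>0 'k\<close> is the algebra of
  noncommutative polynomials.
\<close>

datatype 'g word = Word (letters: "'g list")

instantiation word :: (type) monoid_add
begin

definition zero_word :: "'a word" where "0 = Word []"
definition plus_word :: "'a word \<Rightarrow> 'a word \<Rightarrow> 'a word"
  where "u + v = Word (letters u @ letters v)"

instance by standard (simp_all add: zero_word_def plus_word_def)

end

text \<open>
  An algebra over the field \<open>'k\<close> is represented by a record of type \<^typ>\<open>('k, 'a) module\<close>, i.e. a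
  ring record together with a scalar multiplication.
\<close>

definition free_algebra :: "('k::field, 'g word \<Rightarrow>\<^sub>0 'k) module" where
  "free_algebra =
    \<lparr>carrier = UNIV, mult = (*), one = 1, zero = 0, add = (+),
     smult = (\<lambda>c. Poly_Mapping.map ((*) c))\<rparr>"

definition free_gen :: "'g \<Rightarrow> 'g word \<Rightarrow>\<^sub>0 'k::field" where
  "free_gen g = Poly_Mapping.single (Word [g]) 1"

text \<open>A relation \<open>l = r\<close> is given as the pair \<open>(l, r)\<close>; \<^const>\<open>genideal\<close> is two-sided.\<close>

definition relation_ideal ::
  "(('g word \<Rightarrow>\<^sub>0 'k::field) \<times> ('g word \<Rightarrow>\<^sub>0 'k)) set \<Rightarrow> ('g word \<Rightarrow>\<^sub>0 'k) set" where
  "relation_ideal R = Idl\<^bsub>free_algebra\<^esub> {l \<ominus>\<^bsub>free_algebra\<^esub> r | l r. (l, r) \<in> R}"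

definition quotient_algebra :: "('k, 'a) module \<Rightarrow> 'a set \<Rightarrow> ('k, 'a set) module" where
  "quotient_algebra A I = ring.extend (A Quot I)
    \<lparr>smult = (\<lambda>c X. \<Union>x\<in>X. I +>\<^bsub>A\<^esub> (c \<odot>\<^bsub>A\<^esub> x))\<rparr>"

definition presented_algebra ::
  "(('g word \<Rightarrow>\<^sub>0 'k::field) \<times> ('g word \<Rightarrow>\<^sub>0 'k)) set \<Rightarrow> ('k, ('g word \<Rightarrow>\<^sub>0 'k) set) module" where
  "presented_algebra R = quotient_algebra free_algebra (relation_ideal R)"

definition presented_gen ::
  "(('g word \<Rightarrow>\<^sub>0 'k::field) \<times> ('g word \<Rightarrow>\<^sub>0 'k)) set \<Rightarrow> 'g \<Rightarrow> ('g word \<Rightarrow>\<^sub>0 'k) set" where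
  "presented_gen R g = relation_ideal R +>\<^bsub>free_algebra\<^esub> free_gen g"

definition algebra_iso :: "('k, 'a) module \<Rightarrow> ('k, 'b) module \<Rightarrow> ('a \<Rightarrow> 'b) set" where
  "algebra_iso A B =
    {h \<in> ring_iso A B. \<forall>c. \<forall>x \<in> carrier A. h (c \<odot>\<^bsub>A\<^esub> x) = c \<odot>\<^bsub>B\<^esub> h x}"


section \<open>Commutators\<close>

definition commutator :: "('k::field, 'a) module \<Rightarrow> 'a \<Rightarrow> 'a \<Rightarrow> 'a" where
  "commutator A X Y = X \<otimes>\<^bsub>A\<^esub> Y \<ominus>\<^bsub>A\<^esub> Y \<otimes>\<^bsub>A\<^esub> X"

text \<open>\<open>[X, Y]\<^sub>p = p X Y - p\<^sup>-\<^sup>1 Y X\<close>, used with \<open>p = q\<close> and \<open>p = q\<^sup>-\<^sup>1\<close>.\<close>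

definition qcommutator :: "('k::field, 'a) module \<Rightarrow> 'k \<Rightarrow> 'a \<Rightarrow> 'a \<Rightarrow> 'a" where
  "qcommutator A p X Y = p \<odot>\<^bsub>A\<^esub> (X \<otimes>\<^bsub>A\<^esub> Y) \<ominus>\<^bsub>A\<^esub> inverse p \<odot>\<^bsub>A\<^esub> (Y \<otimes>\<^bsub>A\<^esub> X)"

abbreviation (input) "FA \<equiv> free_algebra"


section \<open>The algebra \<open>U\<close>\<close>

text \<open>\<open>U_Gt k\<close> stands for the generator \<open>G~\<^sub>k\<^sub>+\<^sub>1\<close>.\<close>

datatype U_gen = U_W0 | U_W1 | U_Gt nat

abbreviation "fW0 \<equiv> free_gen U_W0"
abbreviation "fW1 \<equiv> free_gen U_W1"
abbreviation "fGt1 k \<equiv> free_gen (U_Gt k)"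

inductive_set U_relations ::
  "'k::field \<Rightarrow> ((U_gen word \<Rightarrow>\<^sub>0 'k) \<times> (U_gen word \<Rightarrow>\<^sub>0 'k)) set" for q :: 'k where
  "(commutator FA fW0 (qcommutator FA (inverse q) fW0 (qcommutator FA q fW0 fW1)),
    \<zero>\<^bsub>FA\<^esub>) \<in> U_relations q"
| "(commutator FA fW1 (qcommutator FA (inverse q) fW1 (qcommutator FA q fW1 fW0)),
    \<zero>\<^bsub>FA\<^esub>) \<in> U_relations q"
| "(commutator FA (fGt1 0) fW1,
    (q / (q powi 2 - q powi (-2))) \<odot>\<^bsub>FA\<^esub> commutator FA (qcommutator FA q fW0 fW1) fW1)
    \<in> U_relations q"
| "(commutator FA fW0 (fGt1 0),
    (q / (q powi 2 - q powi (-2))) \<odot>\<^bsub>FA\<^esub> commutator FA fW0 (qcommutator FA q fW0 fW1))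
    \<in> U_relations q"
| "(commutator FA (fGt1 (Suc k)) fW1,
    (1 / ((1 - q powi (-2)) * (q powi 2 - q powi (-2)))) \<odot>\<^bsub>FA\<^esub>
      commutator FA (qcommutator FA q (qcommutator FA q (fGt1 k) fW0) fW1) fW1)
    \<in> U_relations q"
| "(commutator FA fW0 (fGt1 (Suc k)),
    (1 / ((1 - q powi (-2)) * (q powi 2 - q powi (-2)))) \<odot>\<^bsub>FA\<^esub>
      commutator FA fW0 (qcommutator FA q fW0 (qcommutator FA q fW1 (fGt1 k))))
    \<in> U_relations q"
| "(commutator FA (fGt1 k) (fGt1 l), \<zero>\<^bsub>FA\<^esub>) \<in> U_relations q"

definition U :: "'k::field \<Rightarrow> ('k, (U_gen word \<Rightarrow>\<^sub>0 'k) set) module" where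
  "U q = presented_algebra (U_relations q)"

abbreviation "U_generator q \<equiv> presented_gen (U_relations q)"

text \<open>
  \<open>Gt_in_U q k = G~\<^sub>k\<close>, \<open>Wm_in_U q k = W\<^sub>-\<^sub>k\<close>, \<open>Wp_in_U q k = W\<^sub>k\<^sub>+\<^sub>1\<close>, \<open>G_in_U q k = G\<^sub>k\<close>; note the
  index shift for \<open>W\<^sub>k\<^sub>+\<^sub>1\<close>.
\<close>

fun Gt_in_U :: "'k::field \<Rightarrow> nat \<Rightarrow> (U_gen word \<Rightarrow>\<^sub>0 'k) set" where
  "Gt_in_U q 0 = \<one>\<^bsub>U q\<^esub>"
| "Gt_in_U q (Suc k) = U_generator q (U_Gt k)"

definition Wm_in_U :: "'k::field \<Rightarrow> nat \<Rightarrow> (U_gen word \<Rightarrow>\<^sub>0 'k) set" where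
  "Wm_in_U q k =
    (1 / (q - inverse q)) \<odot>\<^bsub>U q\<^esub> qcommutator (U q) q (Gt_in_U q k) (U_generator q U_W0)"

definition Wp_in_U :: "'k::field \<Rightarrow> nat \<Rightarrow> (U_gen word \<Rightarrow>\<^sub>0 'k) set" where
  "Wp_in_U q k =
    (1 / (q - inverse q)) \<odot>\<^bsub>U q\<^esub> qcommutator (U q) q (U_generator q U_W1) (Gt_in_U q k)"

fun G_in_U :: "'k::field \<Rightarrow> nat \<Rightarrow> (U_gen word \<Rightarrow>\<^sub>0 'k) set" where
  "G_in_U q 0 = \<one>\<^bsub>U q\<^esub>"
| "G_in_U q (Suc k) =
    Gt_in_U q (Suc k) \<oplus>\<^bsub>U q\<^esub>
      (1 / (1 - q powi (-2))) \<odot>\<^bsub>U q\<^esub> commutator (U q) (U_generator q U_W1) (Wm_in_U q k)"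


section \<open>The alternating central extension \<open>U\<^sub>q\<^sup>+\<close>\<close>

text \<open>
  \<open>Alt_Wm k\<close>, \<open>Alt_Wp k\<close>, \<open>Alt_G k\<close>, \<open>Alt_Gt k\<close> stand for the generators
  \<open>W\<^sub>-\<^sub>k\<close>, \<open>W\<^sub>k\<^sub>+\<^sub>1\<close>, \<open>G\<^sub>k\<^sub>+\<^sub>1\<close>, \<open>G~\<^sub>k\<^sub>+\<^sub>1\<close>.
\<close>

datatype alt_gen = Alt_Wm nat | Alt_Wp nat | Alt_G nat | Alt_Gt nat

abbreviation "aWm k \<equiv> free_gen (Alt_Wm k)"
abbreviation "aWp k \<equiv> free_gen (Alt_Wp k)"
abbreviation "aG1 k \<equiv> free_gen (Alt_G k)"
abbreviation "aGt1 k \<equiv> free_gen (Alt_Gt k)"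

inductive_set Uq_plus_relations ::
  "'k::field \<Rightarrow> ((alt_gen word \<Rightarrow>\<^sub>0 'k) \<times> (alt_gen word \<Rightarrow>\<^sub>0 'k)) set" for q :: 'k where
  "(commutator FA (aWm 0) (aWp k), commutator FA (aWm k) (aWp 0)) \<in> Uq_plus_relations q"
| "(commutator FA (aWm k) (aWp 0), (1 - q powi (-2)) \<odot>\<^bsub>FA\<^esub> (aGt1 k \<ominus>\<^bsub>FA\<^esub> aG1 k))
    \<in> Uq_plus_relations q"
| "(qcommutator FA q (aWm 0) (aG1 k), qcommutator FA q (aGt1 k) (aWm 0))
    \<in> Uq_plus_relations q"
| "(qcommutator FA q (aGt1 k) (aWm 0), (q - inverse q) \<odot>\<^bsub>FA\<^esub> aWm (Suc k))
    \<in> Uq_plus_relations q"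
| "(qcommutator FA q (aG1 k) (aWp 0), qcommutator FA q (aWp 0) (aGt1 k))
    \<in> Uq_plus_relations q"
| "(qcommutator FA q (aWp 0) (aGt1 k), (q - inverse q) \<odot>\<^bsub>FA\<^esub> aWp (Suc k))
    \<in> Uq_plus_relations q"
| "(commutator FA (aWm k) (aWm l), \<zero>\<^bsub>FA\<^esub>) \<in> Uq_plus_relations q"
| "(commutator FA (aWp k) (aWp l), \<zero>\<^bsub>FA\<^esub>) \<in> Uq_plus_relations q"
| "(commutator FA (aWm k) (aWp l) \<oplus>\<^bsub>FA\<^esub> commutator FA (aWp k) (aWm l), \<zero>\<^bsub>FA\<^esub>)
    \<in> Uq_plus_relations q"
| "(commutator FA (aWm k) (aG1 l) \<oplus>\<^bsub>FA\<^esub> commutator FA (aG1 k) (aWm l), \<zero>\<^bsub>FA\<^esub>)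
    \<in> Uq_plus_relations q"
| "(commutator FA (aWm k) (aGt1 l) \<oplus>\<^bsub>FA\<^esub> commutator FA (aGt1 k) (aWm l), \<zero>\<^bsub>FA\<^esub>)
    \<in> Uq_plus_relations q"
| "(commutator FA (aWp k) (aG1 l) \<oplus>\<^bsub>FA\<^esub> commutator FA (aG1 k) (aWp l), \<zero>\<^bsub>FA\<^esub>)
    \<in> Uq_plus_relations q"
| "(commutator FA (aWp k) (aGt1 l) \<oplus>\<^bsub>FA\<^esub> commutator FA (aGt1 k) (aWp l), \<zero>\<^bsub>FA\<^esub>)
    \<in> Uq_plus_relations q"
| "(commutator FA (aG1 k) (aG1 l), \<zero>\<^bsub>FA\<^esub>) \<in> Uq_plus_relations q"
| "(commutator FA (aGt1 k) (aGt1 l), \<zero>\<^bsub>FA\<^esub>) \<in> Uq_plus_relations q"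
| "(commutator FA (aGt1 k) (aG1 l) \<oplus>\<^bsub>FA\<^esub> commutator FA (aG1 k) (aGt1 l), \<zero>\<^bsub>FA\<^esub>)
    \<in> Uq_plus_relations q"

definition Uq_plus :: "'k::field \<Rightarrow> ('k, (alt_gen word \<Rightarrow>\<^sub>0 'k) set) module" where
  "Uq_plus q = presented_algebra (Uq_plus_relations q)"

abbreviation "Uq_plus_generator q \<equiv> presented_gen (Uq_plus_relations q)"


section \<open>Consistency of the encoding\<close>

lemma free_algebra_simps [simp]:
  "carrier free_algebra = UNIV" "x \<otimes>\<^bsub>free_algebra\<^esub> y = x * y" "\<one>\<^bsub>free_algebra\<^esub> = 1"
  "\<zero>\<^bsub>free_algebra\<^esub> = 0" "x \<oplus>\<^bsub>free_algebra\<^esub> y = x + y"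
  "c \<odot>\<^bsub>free_algebra\<^esub> x = Poly_Mapping.single 0 c * x"
  by (simp_all add: free_algebra_def mult_map_scale_conv_mult)

lemma ring_free_algebra: "ring (free_algebra :: ('k::field, 'g word \<Rightarrow>\<^sub>0 'k) module)"
proof (rule ringI)
  show "abelian_group (free_algebra :: ('k, 'g word \<Rightarrow>\<^sub>0 'k) module)"
  proof (rule abelian_groupI)
    show "\<exists>y\<in>carrier free_algebra. y \<oplus>\<^bsub>free_algebra\<^esub> x = \<zero>\<^bsub>free_algebra\<^esub>"
      for x :: "'g word \<Rightarrow>\<^sub>0 'k"
      by (auto intro: exI [of _ "- x"])
  qed (simp_all add: algebra_simps)
  show "Group.monoid (free_algebra :: ('k, 'g word \<Rightarrow>\<^sub>0 'k) module)"
    by (rule monoidI) (simp_all add: mult.assoc)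
qed (simp_all add: algebra_simps)

lemma ideal_relation_ideal: "ideal (relation_ideal R) free_algebra"
  unfolding relation_ideal_def by (rule ring.genideal_ideal [OF ring_free_algebra]) simp

lemma quotient_algebra_simps:
  "carrier (quotient_algebra A I) = carrier (A Quot I)"
  "(\<otimes>\<^bsub>quotient_algebra A I\<^esub>) = (\<otimes>\<^bsub>A Quot I\<^esub>)"
  "\<one>\<^bsub>quotient_algebra A I\<^esub> = \<one>\<^bsub>A Quot I\<^esub>"
  "\<zero>\<^bsub>quotient_algebra A I\<^esub> = \<zero>\<^bsub>A Quot I\<^esub>"
  "(\<oplus>\<^bsub>quotient_algebra A I\<^esub>) = (\<oplus>\<^bsub>A Quot I\<^esub>)"
  "c \<odot>\<^bsub>quotient_algebra A I\<^esub> X = (\<Union>x\<in>X. I +>\<^bsub>A\<^esub> (c \<odot>\<^bsub>A\<^esub> x))"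
  by (simp_all add: quotient_algebra_def ring.defs)

lemma a_minus_quotient_algebra:
  "X \<ominus>\<^bsub>quotient_algebra A I\<^esub> Y = X \<ominus>\<^bsub>A Quot I\<^esub> Y"
  by (simp add: a_minus_def a_inv_def m_inv_def quotient_algebra_simps)

lemma ring_presented_algebra: "ring (presented_algebra R)"
proof -
  interpret ideal "relation_ideal R" free_algebra by (rule ideal_relation_ideal)
  interpret Q: ring "free_algebra Quot relation_ideal R" by (rule quotient_is_ring)
  note simps = presented_algebra_def quotient_algebra_simps
  show ?thesis
  proof (rule ringI)
    show "abelian_group (presented_algebra R)"
      by (rule abelian_groupI) (auto simp: simps Q.a_ac intro: Q.l_neg Q.a_inv_closed)
    show "Group.monoid (presented_algebra R)"
      by (rule monoidI) (auto simp: simps Q.m_assoc)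
  qed (simp_all add: simps Q.l_distr Q.r_distr)
qed

lemma presented_algebra_coset:
  fixes x y :: "'g word \<Rightarrow>\<^sub>0 'k::field" and R
  defines "\<pi> \<equiv> \<lambda>x. relation_ideal R +>\<^bsub>free_algebra\<^esub> x"
  shows "\<pi> x \<otimes>\<^bsub>presented_algebra R\<^esub> \<pi> y = \<pi> (x * y)"
    and "\<pi> x \<oplus>\<^bsub>presented_algebra R\<^esub> \<pi> y = \<pi> (x + y)"
    and "\<pi> x \<ominus>\<^bsub>presented_algebra R\<^esub> \<pi> y = \<pi> (x - y)"
    and "c \<odot>\<^bsub>presented_algebra R\<^esub> \<pi> x = \<pi> (Poly_Mapping.single 0 c * x)"
    and "\<one>\<^bsub>presented_algebra R\<^esub> = \<pi> 1"
proof -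
  interpret ideal "relation_ideal R" free_algebra by (rule ideal_relation_ideal)
  interpret h: ring_hom_ring free_algebra "free_algebra Quot relation_ideal R" \<pi>
    unfolding \<pi>_def by (rule rcos_ring_hom_ring)
  show "\<pi> x \<otimes>\<^bsub>presented_algebra R\<^esub> \<pi> y = \<pi> (x * y)"
    using h.hom_mult [of x y] by (simp add: presented_algebra_def quotient_algebra_simps)
  show "\<pi> x \<oplus>\<^bsub>presented_algebra R\<^esub> \<pi> y = \<pi> (x + y)"
    using h.hom_add [of x y] by (simp add: presented_algebra_def quotient_algebra_simps)
  show "\<pi> x \<ominus>\<^bsub>presented_algebra R\<^esub> \<pi> y = \<pi> (x - y)"
  proof -
    have "\<pi> y \<oplus>\<^bsub>free_algebra Quot relation_ideal R\<^esub> \<pi> (x - y) = \<pi> x"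
      using h.hom_add [of y "x - y"] by simp
    moreover have "\<pi> z \<in> carrier (free_algebra Quot relation_ideal R)" for z
      by (rule h.hom_closed) simp
    ultimately show ?thesis
      by (metis h.S.minus_eq h.S.a_inv_closed h.S.r_neg1 h.S.a_comm presented_algebra_def
          a_minus_quotient_algebra)
  qed
  show "\<one>\<^bsub>presented_algebra R\<^esub> = \<pi> 1"
    using h.hom_one by (simp add: presented_algebra_def quotient_algebra_simps)
  have "\<pi> (Poly_Mapping.single 0 c * x') = \<pi> (Poly_Mapping.single 0 c * x)" if "x' \<in> \<pi> x" for x'
  proof -
    have "\<pi> x' = \<pi> x"
      using a_repr_independence' [of x' x] that by (simp add: \<pi>_def)
    then show ?thesis
      using h.hom_mult [of "Poly_Mapping.single 0 c" x] h.hom_mult [of "Poly_Mapping.single 0 c" x']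
      by simp
  qed
  moreover have "x \<in> \<pi> x"
    unfolding \<pi>_def by (rule a_rcos_self) simp
  ultimately have "(\<Union>x'\<in>\<pi> x. \<pi> (Poly_Mapping.single 0 c * x')) = \<pi> (Poly_Mapping.single 0 c * x)"
    by blast
  then show "c \<odot>\<^bsub>presented_algebra R\<^esub> \<pi> x = \<pi> (Poly_Mapping.single 0 c * x)"
    by (simp add: presented_algebra_def quotient_algebra_simps \<pi>_def)
qed

lemma qcommutator_one:
  fixes q :: "'k::field" and x :: "'g word \<Rightarrow>\<^sub>0 'k" and R
  defines "\<pi> \<equiv> \<lambda>x. relation_ideal R +>\<^bsub>free_algebra\<^esub> x"
  assumes "q - inverse q \<noteq> 0"
  shows "(1 / (q - inverse q)) \<odot>\<^bsub>presented_algebra R\<^esub>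
      qcommutator (presented_algebra R) q \<one>\<^bsub>presented_algebra R\<^esub> (\<pi> x) = \<pi> x"
    and "(1 / (q - inverse q)) \<odot>\<^bsub>presented_algebra R\<^esub>
      qcommutator (presented_algebra R) q (\<pi> x) \<one>\<^bsub>presented_algebra R\<^esub> = \<pi> x"
proof -
  have eq: "Poly_Mapping.single 0 (1 / (q - inverse q)) *
      (Poly_Mapping.single 0 q * x - Poly_Mapping.single 0 (inverse q) * x) = x"
    using assms(2)
    by (simp flip: left_diff_distrib Poly_Mapping.single_diff mult.assoc add: Poly_Mapping.mult_single)
  show "(1 / (q - inverse q)) \<odot>\<^bsub>presented_algebra R\<^esub>
      qcommutator (presented_algebra R) q \<one>\<^bsub>presented_algebra R\<^esub> (\<pi> x) = \<pi> x"
    and "(1 / (q - inverse q)) \<odot>\<^bsub>presented_algebra R\<^esub>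
      qcommutator (presented_algebra R) q (\<pi> x) \<one>\<^bsub>presented_algebra R\<^esub> = \<pi> x"
    by (simp_all add: \<pi>_def qcommutator_def presented_algebra_coset eq)
qed

text \<open>For \<open>k = 0\<close> the defining formulas return the generators \<open>W\<^sub>0\<close> and \<open>W\<^sub>1\<close>.\<close>

lemma Wm_Wp_in_U_0:
  assumes "q - inverse q \<noteq> 0"
  shows "Wm_in_U q 0 = U_generator q U_W0" and "Wp_in_U q 0 = U_generator q U_W1"
  using qcommutator_one [OF assms]
  by (simp_all add: Wm_in_U_def Wp_in_U_def U_def presented_gen_def)

end

theory Submission
  imports Defs "HOL.Vector_Spaces"
begin

text \<open>
  Write \<open>x = W\<^sub>0\<close>, \<open>y = W\<^sub>1\<close>, \<open>g\<^sub>k = G~\<^sub>k\<close>, let \<open>D\<close> be the inner derivation given by a multiple of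
  \<open>[x, y]\<^sub>q\<close> and \<open>e\<^sub>r = D\<^sup>r x\<close>, \<open>f\<^sub>s = D\<^sup>s y\<close>.  The cubic Serre relations alone imply that \<open>D\<close>
  annihilates every \<open>[e\<^sub>r, f\<^sub>s]\<^sub>q\<close>, as for Drinfeld's currents.  Shifted versions of the alternating
  elements, with \<open>e\<^sub>r\<close> and \<open>f\<^sub>s\<close> in place of \<open>x\<close> and \<open>y\<close>, satisfy short recursions in \<open>k\<close>; by
  induction on \<open>k\<close>, \<open>g\<^sub>k\<close> commutes with all \<open>[e\<^sub>r, f\<^sub>s]\<^sub>q\<close> and \<open>[e\<^sub>r, g\<^sub>k\<^sub>+\<^sub>1]\<close>, \<open>[f\<^sub>s, g\<^sub>k\<^sub>+\<^sub>1]\<close> are again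
  shifted alternating elements.  The recursions turn the remaining relations of \<open>U\<^sub>q\<^sup>+\<close> into
  symmetry statements in two indices.  Replacing \<open>q\<close> by its inverse exchanges the roles of \<open>x\<close> and
  \<open>y\<close>, so one-sided facts need only be shown for \<open>x\<close>.
\<close>

section \<open>Commutators in an algebra with parameter \<open>q\<close>\<close>

locale unital_algebra = vector_space scale
  for scale :: "'k::field \<Rightarrow> 'a::ring_1 \<Rightarrow> 'a" (infixr \<open>*s\<close> 75) +
  assumes scale_mult_left: "(c *s u) * v = c *s (u * v)"
    and scale_mult_right: "u * (c *s v) = c *s (u * v)"
begin

definition cm :: "'a \<Rightarrow> 'a \<Rightarrow> 'a" where "cm u v = u * v - v * u"
definition qc :: "'k \<Rightarrow> 'a \<Rightarrow> 'a \<Rightarrow> 'a" where "qc p u v = p *s (u * v) - inverse p *s (v * u)"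

text \<open>Brings an expression in \<open>cm\<close> and \<open>qc\<close> into a linear
  combination of right-associated monomials. Many identities below are proved by this expansion
  alone.\<close>

lemmas expand = cm_def qc_def scale_mult_left scale_mult_right scale_left_distrib scale_right_distrib
  scale_left_diff_distrib scale_right_diff_distrib distrib_left distrib_right left_diff_distrib
  right_diff_distrib mult.assoc

lemma cm_scale [simp]: "cm (c *s u) v = c *s cm u v" "cm u (c *s v) = c *s cm u v"
  by (simp_all add: expand)

lemma scale_eqI: "c \<noteq> 0 \<Longrightarrow> c *s u = c *s v \<Longrightarrow> u = v"
  by simp

text \<open>In a right-associated monomial, \<open>u\<close> and \<open>v\<close> with a further
  factor behind them stand as \<open>u * (v * t)\<close>, where the rule \<open>u * v = w\<close>
  itself does not match.\<close>

lemma assoc_rewrite: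
  fixes u v w t :: 'a
  shows "u * v = w \<Longrightarrow> u * (v * t) = w * t"
  by (metis mult.assoc)

end

locale q_algebra = unital_algebra scale
  for scale :: "'k::field \<Rightarrow> 'a::ring_1 \<Rightarrow> 'a" (infixr \<open>*s\<close> 75) +
  fixes q :: 'k
  assumes q_nonzero: "q \<noteq> 0" and q_power: "\<And>n::nat. n > 0 \<Longrightarrow> q ^ n \<noteq> 1"
begin

section \<open>Scalars that are nonzero because q is not a root of unity\<close>

abbreviation P :: 'k where "P \<equiv> inverse q"

lemma inv_cancel [simp]:
  "q * P = 1" "P * q = 1" "q * (P * z) = z" "P * (q * z) = z"
  using q_nonzero by (simp_all add: mult.assoc [symmetric])

lemma q_power_diff: "n > 0 \<Longrightarrow> q ^ n - P ^ n \<noteq> 0"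
proof
  assume n: "n > 0" and "q ^ n - P ^ n = 0"
  then have "q ^ n * q ^ n = q ^ n * P ^ n" by simp
  also have "\<dots> = 1" by (simp flip: power_mult_distrib)
  finally have "q ^ (n + n) = 1" by (simp add: power_add)
  with n q_power [of "n + n"] show False by simp
qed

lemma q_power_sum: "n > 0 \<Longrightarrow> q ^ n + P ^ n \<noteq> 0"
proof
  assume "n > 0" and z: "q ^ n + P ^ n = 0"
  then have "q ^ (n + n) - P ^ (n + n) \<noteq> 0" by (intro q_power_diff) simp
  moreover have "q ^ (n + n) - P ^ (n + n) = (q ^ n + P ^ n) * (q ^ n - P ^ n)"
    unfolding power_add by (rule square_diff_square_factored)
  ultimately show False using z by simp
qed

lemma q_units:
  "q - P \<noteq> 0" "q + P \<noteq> 0" "q * q - P * P \<noteq> 0" "q * q + P * P \<noteq> 0" "q * q - 1 \<noteq> 0"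
proof -
  show "q - P \<noteq> 0" using q_power_diff [of 1] by simp
  show "q + P \<noteq> 0" using q_power_sum [of 1] by simp
  show "q * q - P * P \<noteq> 0" using q_power_diff [of 2] unfolding power2_eq_square by simp
  show "q * q + P * P \<noteq> 0" using q_power_sum [of 2] unfolding power2_eq_square by simp
  show "q * q - 1 \<noteq> 0" using q_power [of 2] unfolding power2_eq_square by simp
qed

text \<open>The coefficient in relations (iii) and (iv) of U, equal to
  \<open>1 / (q - q^-3)\<close>. It also normalises the derivation \<open>D\<close>.\<close>

definition cc :: 'k where "cc = q / (q * q - P * P)"

lemma cc_inverse: "cc * (q - P * (P * P)) = 1" "(q - P * (P * P)) * cc = 1"
proof -
  have "q * (q - P * (P * P)) = q * q - P * P" by (simp add: algebra_simps)
  with q_units show "cc * (q - P * (P * P)) = 1"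
    by (simp add: cc_def)
  then show "(q - P * (P * P)) * cc = 1" by (simp add: mult.commute)
qed

lemma cc_nonzero: "cc \<noteq> 0"
  using cc_inverse by auto

section \<open>One-sided lemmas on shifted sequences, usable for q and for its inverse\<close>

text \<open>Bracketing the relation \<open>h\<close> at \<open>r\<close> with \<open>u\<close> once
  and twice yields its consequences \<open>d\<close> and \<open>d2\<close>. Bracketing it with
  \<open>w\<close> gives a combination of these and of the relation \<open>h'\<close> at
  \<open>Suc r\<close>, whose coefficient is a unit.\<close>

lemma quadratic_shift:
  fixes e :: "nat \<Rightarrow> 'a" and D :: "'a \<Rightarrow> 'a"
  assumes base: "e 0 * e (Suc 0) = (q * q) *s (e (Suc 0) * e 0)"
    and u: "\<And>r. cm (e r) u = (q - P * (P * P)) *s e (Suc r)"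
    and w: "\<And>r. cm (e r) w = (q * q) *s (e (Suc r) * u) - (P * P) *s (u * e (Suc r))"
  shows "e r * e (Suc r) = (q * q) *s (e (Suc r) * e r)"
proof (induction r)
  case (Suc r)
  let ?m = "q - P * (P * P)" and ?C = "q * q - P * P"
  define h where "h = e r * e (Suc r) - (q * q) *s (e (Suc r) * e r)"
  define h' where "h' = e (Suc r) * e (Suc (Suc r)) - (q * q) *s (e (Suc (Suc r)) * e (Suc r))"
  have u': "u * e r = e r * u - ?m *s e (Suc r)" for r
    using u [of r] by (simp add: cm_def algebra_simps)
  have w': "w * e r = e r * w - ?C *s (e (Suc r) * u) - (P * P * ?m) *s e (Suc (Suc r))" for r
    using w [of r] u' [of "Suc r"] by (simp add: expand algebra_simps)
  note uu = assoc_rewrite [OF u'] and ww = assoc_rewrite [OF w']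
  define d where "d = e (Suc r) * e (Suc r) + e r * e (Suc (Suc r))
    - (q * q) *s (e (Suc (Suc r)) * e r + e (Suc r) * e (Suc r))"
  define d2 where "d2 = e (Suc (Suc r)) * e (Suc r) + e (Suc r) * e (Suc (Suc r)) + e (Suc r) * e (Suc (Suc r)) + e r * e (Suc (Suc (Suc r)))
    - (q * q) *s (e (Suc (Suc (Suc r))) * e r + e (Suc (Suc r)) * e (Suc r) + e (Suc (Suc r)) * e (Suc r) + e (Suc r) * e (Suc (Suc r)))"
  have h: "h = 0" using Suc by (simp add: h_def)
  have "cm h u = ?m *s d"
    by (simp add: h_def d_def expand u' uu algebra_simps)
  then have d: "d = 0" using h cc_inverse by (auto simp: cm_def)
  have "cm d u = ?m *s d2"
    by (simp add: d_def d2_def expand u' uu algebra_simps)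
  then have d2: "d2 = 0" using d cc_inverse by (auto simp: cm_def)
  have "cm h w = ?C *s (d * u) + (P * P * ?m) *s d2 - ((q * q + P * P) * ?m) *s h'"
    by (simp add: h_def h'_def d_def d2_def expand u' w' uu ww algebra_simps)
  then have "h' = 0" using h d d2 cc_inverse q_units by (auto simp: cm_def)
  then show ?case by (simp add: h'_def)
qed (rule base)

text \<open>The step in \<open>k\<close> for the one-sided clauses of \<open>level\<close>:
  \<open>h\<close> is \<open>g (Suc k)\<close>, and \<open>a\<close>, \<open>a'\<close> are the
  shifted alternating elements at \<open>k\<close> and \<open>Suc k\<close>. Inserting
  \<open>a'\<close> and moving \<open>e r\<close> past \<open>h\<close> reduces the first claim to
  \<open>H\<close>, the second to \<open>ee\<close>, \<open>L\<close> and \<open>H'\<close>.\<close>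

lemma twisted_step:
  fixes e a a' :: "nat \<Rightarrow> 'a" and h :: 'a
  assumes eh: "\<And>r. e r * h = h * e r + a (Suc r)"
    and a': "\<And>r. (q * q - 1) *s a' r = (q * q - 1) *s (h * e r) - a (Suc r)"
    and ee: "\<And>r. e r * e (Suc r) = (q * q) *s (e (Suc r) * e r)"
    and L: "\<And>r. e r * a r = a r * e r"
    and H: "\<And>r. e r * a (Suc r) = (q * q) *s (a (Suc r) * e r)"
    and H': "\<And>r. e (Suc r) * a (Suc r) + e r * a (Suc (Suc r))
      = (q * q) *s (a (Suc (Suc r)) * e r + a (Suc r) * e (Suc r))"
  shows "e r * a' r = a' r * e r" and "e r * a' (Suc r) = (q * q) *s (a' (Suc r) * e r)"
proof -
  have "(q * q - 1) *s (e r * a' r - a' r * e r)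
      = e r * ((q * q - 1) *s a' r) - ((q * q - 1) *s a' r) * e r"
    by (simp add: scale_mult_left scale_mult_right scale_right_diff_distrib)
  also have "\<dots> = 0"
    unfolding a' using assoc_rewrite [OF eh [of r]] by (simp add: expand H)
  finally show "e r * a' r = a' r * e r"
    using q_units by simp
  have "(q * q - 1) *s (e r * a' (Suc r) - (q * q) *s (a' (Suc r) * e r))
      = e r * ((q * q - 1) *s a' (Suc r)) - (q * q) *s (((q * q - 1) *s a' (Suc r)) * e r)"
    by (simp add: scale_mult_left scale_mult_right scale_right_diff_distrib mult.commute)
  also have "\<dots> = (e (Suc r) * a (Suc r) - a (Suc r) * e (Suc r)) - (e (Suc r) * a (Suc r) + e r * a (Suc (Suc r))
      - (q * q) *s (a (Suc (Suc r)) * e r + a (Suc r) * e (Suc r)))"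
    unfolding a' using assoc_rewrite [OF eh [of r]] by (simp add: expand ee algebra_simps)
  also have "\<dots> = 0"
    using L [of "Suc r"] H' [of r] by simp
  finally show "e r * a' (Suc r) = (q * q) *s (a' (Suc r) * e r)"
    using q_units by simp
qed

text \<open>The recursion for \<open>a\<close> lowers \<open>i\<close> by one at the cost of raising
  \<open>r\<close>. Applied twice, it leaves a product symmetric in \<open>i\<close> and
  \<open>j\<close> and brackets of smaller index sum, which the induction hypothesis
  interchanges.\<close>

lemma bracket_symmetric:
  fixes e g :: "nat \<Rightarrow> 'a" and a :: "nat \<Rightarrow> nat \<Rightarrow> 'a"
  assumes g: "\<And>i j. g i * g j = g j * g i"
    and eg: "\<And>r k. cm (e r) (g (Suc k)) = a (Suc r) k"
    and a_0: "\<And>r. a r 0 = e r"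
    and a_Suc: "\<And>r k. (q * q - 1) *s a r (Suc k) = (q * q - 1) *s (g (Suc k) * e r) - a (Suc r) k"
  shows "cm (a r i) (g (Suc j)) = cm (a r j) (g (Suc i))"
proof -
  let ?k = "q * q - 1"
  have rec: "?k *s cm (a r (Suc i)) (g (Suc j)) = ?k *s (g (Suc i) * a (Suc r) j) - cm (a (Suc r) i) (g (Suc j))"
    for r i j
  proof -
    have "?k *s cm (a r (Suc i)) (g (Suc j)) = cm (?k *s a r (Suc i)) (g (Suc j))"
      by simp
    also have "\<dots> = ?k *s (g (Suc i) * cm (e r) (g (Suc j))) - cm (a (Suc r) i) (g (Suc j))"
      unfolding a_Suc using assoc_rewrite [OF g [of "Suc j" "Suc i"]] by (simp add: expand)
    finally show ?thesis by (simp add: eg)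
  qed
  \<comment> \<open>The boundary case: by \<open>a_0\<close> and \<open>eg\<close> this is also the
    value of \<open>cm (a r 0) (g (Suc j))\<close>.\<close>
  have g1: "cm (a r j) (g (Suc 0)) = a (Suc r) j" for r j
  proof (induction j arbitrary: r)
    case (Suc j)
    have "?k *s cm (a r (Suc j)) (g (Suc 0)) = ?k *s a (Suc r) (Suc j)"
      using rec [of r j 0] Suc [of "Suc r"] by (simp add: a_0 a_Suc)
    then show ?case using q_units by simp
  qed (simp add: a_0 eg)
  show ?thesis
  proof (induction "i + j" arbitrary: r i j rule: less_induct)
    case less
    show ?case
    proof (cases i; cases j)
      fix i' j' assume i: "i = Suc i'" and j: "j = Suc j'"
      have expand2: "?k *s ?k *s cm (a r (Suc i)) (g (Suc (Suc j)))
        = ?k *s ?k *s (g (Suc i) * (g (Suc j) * e (Suc r)))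
          - ?k *s cm (a (Suc r) (Suc i)) (g (Suc j)) - cm (a (Suc (Suc r)) i) (g (Suc j))
          - ?k *s cm (a (Suc r) i) (g (Suc (Suc j)))" for i j
        unfolding rec scale_right_diff_distrib
        by (simp add: a_Suc scale_right_diff_distrib right_diff_distrib flip: scale_mult_right)
      have "?k *s ?k *s cm (a r i) (g (Suc j)) = ?k *s ?k *s cm (a r j) (g (Suc i))"
        unfolding i j expand2
        using less [of "Suc i'" j' "Suc r"] less [of i' "Suc j'" "Suc r"] less [of i' j' "Suc (Suc r)"] i j
          assoc_rewrite [OF g [of "Suc j'" "Suc i'"]]
        by (simp add: mult.assoc)
      then show ?thesis using q_units by simp
    qed (simp_all add: a_0 eg g1)
  qed
qed

text \<open>Since \<open>a0 i\<close> commutes with \<open>e0\<close>, its bracket with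
  \<open>a0 (Suc j)\<close> is a q-bracket of \<open>cm (a0 i) (g (Suc j))\<close> with
  \<open>e0\<close>, hence symmetric in \<open>i\<close> and \<open>j\<close>. This shifts index
  from one factor to the other until one of them is \<open>e0\<close>.\<close>

lemma twisted_commute:
  fixes e0 :: 'a and g a0 :: "nat \<Rightarrow> 'a"
  assumes sym: "\<And>i j. cm (a0 i) (g (Suc j)) = cm (a0 j) (g (Suc i))"
    and comm: "\<And>i. a0 i * e0 = e0 * a0 i"
    and a0: "\<And>k. (q - P) *s a0 k = qc q (g k) e0" and a0_0: "a0 0 = e0"
  shows "a0 i * a0 j = a0 j * a0 i"
proof (induction i arbitrary: j)
  case 0
  then show ?case by (simp add: a0_0 comm)
next
  case (Suc i)
  have "(q - P) *s cm (a0 i) (a0 (Suc j)) = qc q (cm (a0 i) (g (Suc j))) e0" for i j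
  proof -
    have "(q - P) *s cm (a0 i) (a0 (Suc j)) = cm (a0 i) ((q - P) *s a0 (Suc j))"
      by simp
    also have "\<dots> = qc q (cm (a0 i) (g (Suc j))) e0"
      unfolding a0 using comm [of i] assoc_rewrite [OF comm [of i]] by (simp add: expand)
    finally show ?thesis .
  qed
  then have "(q - P) *s cm (a0 i) (a0 (Suc j)) = (q - P) *s cm (a0 j) (a0 (Suc i))"
    by (simp add: sym [of i j])
  then have "cm (a0 i) (a0 (Suc j)) = cm (a0 j) (a0 (Suc i))"
    using q_units by simp
  then show ?case
    using Suc [of "Suc j"] by (simp add: cm_def)
qed

lemma qc_scale [simp]: "qc p (c *s u) v = c *s qc p u v" "qc p u (c *s v) = c *s qc p u v"
  by (simp_all add: expand mult.commute)

lemma one_bracket: "(1 / (q - P)) *s qc q 1 u = u" "(1 / (q - P)) *s qc q u 1 = u"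
  using q_units by (simp_all add: qc_def flip: scale_left_diff_distrib)

lemma minus_P2: "1 - P * P \<noteq> 0"
proof
  assume "1 - P * P = 0"
  then have "q * q * (1 - P * P) = 0" by simp
  then show False using q_units by (simp add: algebra_simps)
qed

text \<open>Splits the coefficient of relations (v) and (vi) into that of (iii), (iv) and the
  normalisation \<open>1 / (q - P)\<close> of the innermost bracket.\<close>

lemma coefficient: "1 / ((1 - P * P) * (q * q - P * P)) = cc / (q - P)"
proof -
  have "q * (1 - P * P) = q - P" by (simp add: algebra_simps)
  then have "cc / (q - P) = q / ((q * (1 - P * P)) * (q * q - P * P))"
    by (simp add: cc_def)
  then show ?thesis using q_nonzero by simp
qed

text \<open>The passage from the alternating presentation back to that of U; \<open>G k\<close> and
  \<open>H k\<close> stand for the generators G and G~ of index k+1. Eliminating \<open>G k\<close>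
  expresses the brackets of \<open>H k\<close> with \<open>A 0\<close> and \<open>B 0\<close>
  through \<open>cm (A k) (B 0)\<close>.\<close>

lemma compact_from_alternating:
  fixes A B G H :: "nat \<Rightarrow> 'a"
  assumes AB: "cm (A 0) (B k) = cm (A k) (B 0)"
    and A_B: "\<And>k. cm (A k) (B 0) = (1 - P * P) *s (H k - G k)"
    and A_G: "\<And>k. qc q (A 0) (G k) = qc q (H k) (A 0)"
    and H_A: "\<And>k. qc q (H k) (A 0) = (q - P) *s A (Suc k)"
    and G_B: "\<And>k. qc q (G k) (B 0) = qc q (B 0) (H k)"
    and B_H: "\<And>k. qc q (B 0) (H k) = (q - P) *s B (Suc k)"
    and AA: "cm (A 0) (A (Suc 0)) = 0" and BB: "cm (B 0) (B (Suc 0)) = 0"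
  shows "cm (H k) (B 0) = cc *s cm (qc q (A k) (B 0)) (B 0)"
    and "cm (A 0) (H k) = cc *s cm (A 0) (qc q (A 0) (B k))"
    and "cm (A 0) (qc P (A 0) (qc q (A 0) (B 0))) = 0"
    and "cm (B 0) (qc P (B 0) (qc q (B 0) (A 0))) = 0"
proof -
  have G_scaled: "(1 - P * P) *s G k = (1 - P * P) *s H k - cm (A k) (B 0)" for k
    by (simp add: A_B scale_right_diff_distrib)
  have "(q - P * (P * P)) *s cm (H k) (B 0) - qc q (cm (A k) (B 0)) (B 0)
      = qc q ((1 - P * P) *s G k) (B 0) - (1 - P * P) *s qc q (B 0) (H k)" for k
    unfolding G_scaled by (simp add: expand algebra_simps)
  then have "cc *s (q - P * (P * P)) *s cm (H k) (B 0) = cc *s qc q (cm (A k) (B 0)) (B 0)" for k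
    by (simp add: G_B)
  then have HB: "cm (H k) (B 0) = cc *s qc q (cm (A k) (B 0)) (B 0)" for k
    by (simp add: cc_inverse)
  then show "cm (H k) (B 0) = cc *s cm (qc q (A k) (B 0)) (B 0)"
    by (simp add: expand)
  have "(q - P * (P * P)) *s cm (A 0) (H k) - qc q (A 0) (cm (A k) (B 0))
      = qc q (A 0) ((1 - P * P) *s G k) - (1 - P * P) *s qc q (H k) (A 0)" for k
    unfolding G_scaled by (simp add: expand algebra_simps)
  then have "cc *s (q - P * (P * P)) *s cm (A 0) (H k) = cc *s qc q (A 0) (cm (A k) (B 0))" for k
    by (simp add: A_G)
  then have AH: "cm (A 0) (H k) = cc *s qc q (A 0) (cm (A k) (B 0))" for k
    by (simp add: cc_inverse)
  moreover have "cm (A 0) (qc q (A 0) (B k)) = qc q (A 0) (cm (A 0) (B k))"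
    by (simp add: expand)
  ultimately show "cm (A 0) (H k) = cc *s cm (A 0) (qc q (A 0) (B k))"
    by (simp add: AB)
  \<comment> \<open>Both Serre expressions can be written with a plain bracket innermost. There
    \<open>AH\<close> and \<open>HB\<close> apply, and what remains is a multiple of
    \<open>cm (A 0) (A (Suc 0))\<close> or \<open>cm (B 0) (B (Suc 0))\<close>.\<close>
  have serre_A: "cm u (qc P u (qc q u v)) = - qc q (qc q u (cm u v)) u" for u v
    by (simp add: expand algebra_simps)
  have serre_B: "cm v (qc P v (qc q v u)) = qc q v (qc q (cm u v) v)" for u v
    by (simp add: expand algebra_simps)
  have "cc *s cm (A 0) (qc P (A 0) (qc q (A 0) (B 0))) = - qc q (cm (A 0) (H 0)) (A 0)"
    unfolding AH serre_A by simp
  also have "\<dots> = - cm (A 0) (qc q (H 0) (A 0))"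
    by (simp add: expand algebra_simps)
  also have "\<dots> = 0"
    unfolding H_A by (simp add: AA)
  finally show "cm (A 0) (qc P (A 0) (qc q (A 0) (B 0))) = 0"
    using cc_nonzero by simp
  have "cc *s cm (B 0) (qc P (B 0) (qc q (B 0) (A 0))) = qc q (B 0) (cm (H 0) (B 0))"
    unfolding HB serre_B [of _ "A 0"] by simp
  also have "\<dots> = - cm (B 0) (qc q (B 0) (H 0))"
    by (simp add: expand algebra_simps)
  also have "\<dots> = 0"
    unfolding B_H by (simp add: BB)
  finally show "cm (B 0) (qc P (B 0) (qc q (B 0) (A 0))) = 0"
    using cc_nonzero by simp
qed

text \<open>The mirror symmetry: the one-sided lemmas above, instantiated at \<open>P\<close>, give
  the facts on \<open>f\<close> and \<open>b\<close>.\<close>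

lemma q_inverse: "q_algebra scale P"
  using q_nonzero q_power
  by unfold_locales (auto simp: power_inverse)

end

section \<open>Consequences of the Serre relations\<close>

locale serre_pair = q_algebra scale q
  for scale :: "'k::field \<Rightarrow> 'a::ring_1 \<Rightarrow> 'a" (infixr \<open>*s\<close> 75) and q :: 'k +
  fixes x y :: 'a
  assumes serre_x: "cm x (qc P x (qc q x y)) = 0"
    and serre_y: "cm y (qc P y (qc q y x)) = 0"
begin

definition D :: "'a \<Rightarrow> 'a" where "D u = cc *s cm u (qc q x y)"
definition e :: "nat \<Rightarrow> 'a" where "e r = (D ^^ r) x"
definition f :: "nat \<Rightarrow> 'a" where "f r = (D ^^ r) y"
text \<open>In the positive part of quantum affine sl2, up to scalars, \<open>e r\<close> and
  \<open>f r\<close> are real root vectors and the \<open>sg r s\<close> imaginary ones.\<close>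

definition sg :: "nat \<Rightarrow> nat \<Rightarrow> 'a" where "sg r s = qc q (e r) (f s)"
abbreviation S :: "nat \<Rightarrow> 'a" where "S n \<equiv> sg n 0"

lemma e_0 [simp]: "e 0 = x" and f_0 [simp]: "f 0 = y"
  by (simp_all add: e_def f_def)

lemma D_e [simp]: "D (e r) = e (Suc r)" and D_f [simp]: "D (f r) = f (Suc r)"
  by (simp_all add: e_def f_def)

lemma D_scaled: "cm u (S 0) = (q - P * (P * P)) *s D u"
  by (simp add: D_def sg_def cc_inverse)

lemma D_0 [simp]: "D 0 = 0"
  and D_mult: "D (u * v) = D u * v + u * D v"
  and D_diff: "D (u - v) = D u - D v"
  and D_scale: "D (c *s u) = c *s D u"
  by (simp_all add: D_def expand mult.left_commute mult.commute)

lemma D_cm: "D (cm u v) = cm (D u) v + cm u (D v)"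
  and D_qc: "D (qc p u v) = qc p (D u) v + qc p u (D v)"
  by (simp_all add: expand D_mult D_diff D_scale)

lemma e_S0: "cm (e r) (S 0) = (q - P * (P * P)) *s e (Suc r)"
  and f_S0: "cm (f s) (S 0) = (q - P * (P * P)) *s f (Suc s)"
  by (simp_all add: D_scaled)

text \<open>The plain bracket with \<open>x\<close> can be moved inside the surrounding bracket with
  \<open>x\<close>. The Serre relation then becomes a q-commutation of \<open>x\<close> with
  \<open>D x\<close>.\<close>

lemma x_e1: "x * e (Suc 0) = (q * q) *s (e (Suc 0) * x)"
proof -
  have "P *s (x * cm x (qc q x y)) - q *s (cm x (qc q x y) * x) = cm x (qc P x (qc q x y))"
    by (simp add: expand algebra_simps)
  then have "cc *s q *s (P *s (x * cm x (qc q x y)) - q *s (cm x (qc q x y) * x)) = 0"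
    by (simp add: serre_x)
  then show ?thesis
    by (simp add: e_def D_def scale_mult_left scale_mult_right scale_right_diff_distrib
      ac_simps)
qed

lemma y_f1: "y * f (Suc 0) = (P * P) *s (f (Suc 0) * y)"
proof -
  have "q *s (y * cm y (qc q x y)) - P *s (cm y (qc q x y) * y) = - cm y (qc P y (qc q y x))"
    by (simp add: expand algebra_simps)
  then have "cc *s P *s (q *s (y * cm y (qc q x y)) - P *s (cm y (qc q x y) * y)) = 0"
    by (simp add: serre_y)
  then show ?thesis
    by (simp add: f_def D_def scale_mult_left scale_mult_right scale_right_diff_distrib
      ac_simps)
qed

section \<open>Vanishing of D on the q-brackets of the two sequences\<close>

lemma D_sg: "D (sg r s) = sg (Suc r) s + sg r (Suc s)"
  by (simp add: sg_def D_qc)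

lemma x_sg: "cm x (sg (Suc 0) j) = (q * q) *s (e (Suc 0) * sg 0 j) - (P * P) *s (sg 0 j * e (Suc 0))"
  using assoc_rewrite [OF x_e1] x_e1 by (simp add: sg_def expand)

lemma y_sg: "cm y (sg i (Suc 0)) = (P * P) *s (f (Suc 0) * sg i 0) - (q * q) *s (sg i 0 * f (Suc 0))"
proof -
  have "f (Suc 0) * y = (q * q) *s (y * f (Suc 0))" using y_f1 by (simp add: mult.assoc)
  then show ?thesis
    using assoc_rewrite [of "f (Suc 0)" y] by (simp add: sg_def expand)
qed

text \<open>\<open>D (sg r s)\<close> is the sum of the two neighbours with index sum
  \<open>r + s + 1\<close>. Its vanishing therefore fixes the next antidiagonal up to sign, so a
  hypothesis for \<open>m < n\<close> reaches \<open>r + s = n\<close>.\<close>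

lemma sg_sign:
  assumes "\<And>m. m < n \<Longrightarrow> D (S m) = 0"
  shows "r + s \<le> n \<Longrightarrow> sg r s = (- 1) ^ s *s S (r + s)"
proof (induction s arbitrary: r)
  case (Suc s)
  have "D (sg r s) = 0"
    using Suc assms by (simp add: D_scale)
  then have "sg r (Suc s) = - sg (Suc r) s"
    using D_sg [of r s] by (simp add: add_eq_0_iff)
  with Suc show ?case by simp
qed simp

text \<open>Pulls \<open>w\<close> out of both q-brackets at the cost of commutators with
  \<open>u'\<close> and \<open>v'\<close>. It is applied with \<open>w = S i\<close>,
  \<open>u = e (Suc j)\<close>, \<open>v' = y\<close>, \<open>u' = e j\<close>,
  \<open>v = f (Suc 0)\<close>, where \<open>qc q u v'\<close> and \<open>qc q u' v\<close> are
  \<open>S (Suc j)\<close> up to sign.\<close>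

lemma exchange:
  "qc q ((q * q) *s (u * w) - (P * P) *s (w * u)) v' + qc q u' ((q * q) *s (w * v) - (P * P) *s (v * w))
    = (q * q) *s (qc q u v' * w + w * qc q u' v) - (P * P) *s (w * qc q u v' + qc q u' v * w)
      - (q * q * q) *s (u * cm v' w - cm u' w * v) + (P * P * P) *s (cm v' w * u - v * cm u' w)"
  by (simp add: expand algebra_simps)

text \<open>
  Put \<open>\<theta>\<^sub>i = [S\<^sub>n\<^sub>-\<^sub>i, S\<^sub>i]\<close>.  Expanding through the action of \<open>S\<^sub>i\<close> on \<open>e\<^sub>j\<close> and \<open>y\<close> gives a three-term recursion
  in \<open>i\<close>, so \<open>\<theta>\<^sub>n\<close> is an explicit multiple of \<open>\<theta>\<^sub>0\<close>; antisymmetry \<open>\<theta>\<^sub>n = - \<theta>\<^sub>0\<close> then forces \<open>\<theta>\<^sub>0 = 0\<close>.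
\<close>

lemma D_S_step:
  assumes IH: "\<And>m. m < n \<Longrightarrow> D (S m) = 0" and n: "n > 0"
  shows "D (S n) = 0"
proof -
  have sign: "sg r s = (- 1) ^ s *s S (r + s)" if "r + s \<le> n" for r s
    using sg_sign IH that by blast
  have sg1: "sg i (Suc 0) = - S (Suc i)" if "i < n" for i
    using sign [of i "Suc 0"] that by simp
  have x_S: "cm x (S (Suc i)) = (q * q) *s (e (Suc 0) * S i) - (P * P) *s (S i * e (Suc 0))" if "i < n" for i
  proof -
    have "sg (Suc 0) i = (- 1) ^ i *s S (Suc i)" "sg 0 i = (- 1) ^ i *s S i"
      using sign [of "Suc 0" i] sign [of 0 i] that by simp_all
    then have "(- 1) ^ i *s cm x (S (Suc i))
        = (- 1) ^ i *s ((q * q) *s (e (Suc 0) * S i) - (P * P) *s (S i * e (Suc 0)))"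
      using x_sg [of i] by (simp add: expand mult.commute)
    then show ?thesis by simp
  qed
  have y_S: "cm y (S (Suc i)) = (q * q) *s (S i * f (Suc 0)) - (P * P) *s (f (Suc 0) * S i)" if "i < n" for i
    using y_sg [of i] sg1 [OF that] by (simp add: expand algebra_simps)
  \<comment> \<open>\<open>D\<close> is applied \<open>r\<close> times to \<open>x_S\<close>. For
    \<open>r > 0\<close> the bound gives \<open>Suc i < n\<close>, so \<open>D\<close> kills both
    \<open>S i\<close> and \<open>S (Suc i)\<close>.\<close>
  have e_S: "cm (e r) (S (Suc i)) = (q * q) *s (e (Suc r) * S i) - (P * P) *s (S i * e (Suc r))"
    if "Suc i + r \<le> n" for i r
    using that
  proof (induction r)
    case 0
    then show ?case using x_S [of i] by simp
  next
    case (Suc r)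
    have "D (S i) = 0" "D (S (Suc i)) = 0" using Suc.prems by (auto intro: IH)
    then show ?case
      using arg_cong [OF Suc.IH, of D] Suc.prems by (simp add: D_cm D_diff D_scale D_mult) (simp add: cm_def)
  qed
  have Leibniz: "cm (qc q u v) w = qc q (cm u w) v + qc q u (cm v w)" for u v w
    by (simp add: expand algebra_simps)
  have sg_j1: "qc q (e j) (f (Suc 0)) = - S (Suc j)" if "j < n" for j
    using sg1 [OF that] by (simp add: sg_def)
  have exch: "cm (S j) (S (Suc i)) = (q * q + P * P) *s cm (S (Suc j)) (S i)
      - (q * q * q) *s (e (Suc j) * cm y (S i) - cm (e j) (S i) * f (Suc 0))
      + (P * P * P) *s (cm y (S i) * e (Suc j) - f (Suc 0) * cm (e j) (S i))"
    if "Suc i + j = n" for i j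
  proof -
    have "cm (S j) (S (Suc i)) = qc q (cm (e j) (S (Suc i))) y + qc q (e j) (cm y (S (Suc i)))"
      by (simp add: sg_def Leibniz)
    also have "\<dots> = qc q ((q * q) *s (e (Suc j) * S i) - (P * P) *s (S i * e (Suc j))) y
        + qc q (e j) ((q * q) *s (S i * f (Suc 0)) - (P * P) *s (f (Suc 0) * S i))"
      using that by (simp add: e_S y_S)
    also have "\<dots> = (q * q) *s (S (Suc j) * S i - S i * S (Suc j))
      - (P * P) *s (S i * S (Suc j) - S (Suc j) * S i)
      - (q * q * q) *s (e (Suc j) * cm y (S i) - cm (e j) (S i) * f (Suc 0))
      + (P * P * P) *s (cm y (S i) * e (Suc j) - f (Suc 0) * cm (e j) (S i))"
      using that sg_j1 [of j] by (subst exchange) (simp add: sg_def [of "Suc j" 0])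
    finally show ?thesis
      by (simp add: cm_def algebra_simps)
  qed
  define t where "t i = cm (S (n - i)) (S i)" for i
  have t_1: "t (Suc 0) = (q * q + P * P) *s t 0"
  proof -
    obtain j where j: "n = Suc j" using n by (cases n) auto
    show ?thesis
      using exch [of 0 j] f_S0 [of 0] e_S0 [of j]
      by (simp add: t_def j scale_mult_left scale_mult_right)
  qed
  \<comment> \<open>The correction terms of \<open>exch\<close>, rewritten by \<open>y_S\<close> and
    \<open>e_S\<close>, collapse to the bracket of \<open>qc q (e (Suc j)) (f (Suc 0))\<close> with
    \<open>S i\<close>, which is \<open>- t i\<close>.\<close>
  have t_step: "t (Suc (Suc i)) = (q * q + P * P) *s t (Suc i) - t i" if i: "Suc (Suc i) \<le> n" for i
  proof -
    obtain j where j: "n = Suc (Suc i) + j" using i le_Suc_ex by blast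
    have yS: "cm y (S (Suc i)) = (q * q) *s (S i * f (Suc 0)) - (P * P) *s (f (Suc 0) * S i)"
      and eS: "cm (e j) (S (Suc i)) = (q * q) *s (e (Suc j) * S i) - (P * P) *s (S i * e (Suc j))"
      using j by (simp_all add: y_S e_S)
    have "cm (S j) (S (Suc (Suc i))) = (q * q + P * P) *s cm (S (Suc j)) (S (Suc i))
      + cm (qc q (e (Suc j)) (f (Suc 0))) (S i)"
      unfolding exch [of "Suc i" j, unfolded j, simplified, unfolded yS eS]
      by (simp add: expand algebra_simps)
    also have "qc q (e (Suc j)) (f (Suc 0)) = - S (Suc (Suc j))"
      using j by (intro sg_j1) simp
    finally show ?thesis
      by (simp add: t_def j cm_def)
  qed
  \<comment> \<open>The recursion is that of the quantum integers at q^2, so \<open>t i\<close> is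
    \<open>[i + 1]\<close> times \<open>t 0\<close>.\<close>
  have t_closed: "(q * q - P * P) *s t i = ((q * q) ^ Suc i - (P * P) ^ Suc i) *s t 0" if "i \<le> n" for i
    using that
  proof (induction i rule: induct_nat_012)
    case 0
    then show ?case by simp
  next
    case 1
    then show ?case using t_1 by (simp add: algebra_simps)
  next
    case (ge2 i)
    have "(q * q - P * P) *s t (Suc (Suc i))
      = (q * q + P * P) *s (q * q - P * P) *s t (Suc i) - (q * q - P * P) *s t i"
      unfolding t_step [OF ge2.prems] by (simp add: scale_right_diff_distrib mult.commute)
    also have "\<dots> = (q * q + P * P) *s ((q * q) ^ Suc (Suc i) - (P * P) ^ Suc (Suc i)) *s t 0
        - ((q * q) ^ Suc i - (P * P) ^ Suc i) *s t 0"
      using ge2 by simp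
    also have "\<dots> = ((q * q) ^ Suc (Suc (Suc i)) - (P * P) ^ Suc (Suc (Suc i))) *s t 0"
      by (simp add: algebra_simps)
    finally show ?case .
  qed
  have "t n = - t 0"
    by (simp add: t_def cm_def)
  then have "((q * q) ^ Suc n - (P * P) ^ Suc n + (q * q - P * P)) *s t 0 = 0"
    unfolding scale_left_distrib t_closed [OF order_refl, symmetric] by simp
  \<comment> \<open>Up to the denominator this is \<open>[n + 1] + 1\<close>. Both factors are
    nonzero because \<open>q\<close> is not a root of unity.\<close>
  moreover have "(q * q) ^ Suc n - (P * P) ^ Suc n + (q * q - P * P)
    = (q ^ (n + 2) - P ^ (n + 2)) * (q ^ n + P ^ n)"
  proof -
    have qP: "q ^ n * P ^ n = 1" by (simp flip: power_mult_distrib)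
    have "(q ^ (n + 2) - P ^ (n + 2)) * (q ^ n + P ^ n)
        = (q * q) ^ Suc n - (P * P) ^ Suc n + (q ^ n * P ^ n) * (q * q - P * P)"
      by (simp add: power_add power_mult_distrib power2_eq_square algebra_simps del: inv_cancel)
    then show ?thesis unfolding qP by simp
  qed
  ultimately have "t 0 = 0"
    using q_power_diff [of "n + 2"] q_power_sum [of n] n by simp
  then show ?thesis
    using D_scaled [of "S n"] cc_inverse by (auto simp: t_def)
qed

lemma D_sg_0: "D (sg r s) = 0"
proof -
  have S: "D (S n) = 0" for n
  proof (induction n rule: less_induct)
    case (less n)
    show ?case
    proof (cases "n = 0")
      case True
      then show ?thesis by (simp add: D_def sg_def cm_def)
    next
      case False
      then show ?thesis using D_S_step less by blast
    qed
  qed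
  then show ?thesis
    using sg_sign [of "r + s" r s] by (simp add: D_scale)
qed

lemma sg_Suc: "sg (Suc r) s + sg r (Suc s) = 0"
  using D_sg [of r s] D_sg_0 [of r s] by simp

text \<open>\<open>D\<close> propagates the case \<open>r = 0\<close>, as it kills
  \<open>S 0\<close> and \<open>S (Suc 0)\<close>. With \<open>e_S0\<close> this supplies
  \<open>w = S (Suc 0)\<close> and \<open>u = S 0\<close> for
  \<open>quadratic_shift\<close>.\<close>

lemma e_S1: "cm (e r) (S (Suc 0)) = (q * q) *s (e (Suc r) * S 0) - (P * P) *s (S 0 * e (Suc r))"
proof (induction r)
  case 0
  then show ?case using x_sg [of 0] by simp
next
  case (Suc r)
  show ?case
    using arg_cong [OF Suc.IH, of D] by (simp add: D_cm D_diff D_scale D_mult D_sg_0) (simp add: cm_def)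
qed

lemma f_S1: "cm (f s) (S (Suc 0)) = (q * q) *s (S 0 * f (Suc s)) - (P * P) *s (f (Suc s) * S 0)"
proof (induction s)
  case 0
  have "S (Suc 0) = - sg 0 (Suc 0)" using sg_Suc [of 0 0] by (simp add: add_eq_0_iff)
  then show ?case using y_sg [of 0] by (simp add: cm_def algebra_simps)
next
  case (Suc r)
  show ?case
    using arg_cong [OF Suc.IH, of D] by (simp add: D_cm D_diff D_scale D_mult D_sg_0) (simp add: cm_def)
qed

lemma e_e: "e r * e (Suc r) = (q * q) *s (e (Suc r) * e r)"
  by (rule quadratic_shift [where u = "S 0" and w = "S (Suc 0)"])
    (use x_e1 e_S0 e_S1 in \<open>simp_all add: D_mult D_scale\<close>)

lemma f_f: "f r * f (Suc r) = (P * P) *s (f (Suc r) * f r)"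
proof -
  have f_S0': "f s * S 0 = S 0 * f s + (q - P * (P * P)) *s f (Suc s)" for s
    using f_S0 [of s] by (simp add: cm_def algebra_simps)
  have f_S1': "f s * S (Suc 0) = S (Suc 0) * f s + (q * q) *s (S 0 * f (Suc s)) - (P * P) *s (f (Suc s) * S 0)" for s
    using f_S1 [of s] by (simp add: cm_def algebra_simps)
  show ?thesis
    \<comment> \<open>Inverting \<open>q\<close> turns the shift factor into
      \<open>P - q^3 = - q^2 (q - P^3)\<close>, which dictates the scalar of \<open>u\<close>. The
      scalar of \<open>w\<close> then brings \<open>f_S1\<close> into the required form.\<close>
    by (rule q_algebra.quadratic_shift [OF q_inverse, where u = "- ((q * q) *s S 0)" and w = "(q * q) *s S (Suc 0)"])
      (simp_all add: y_f1 expand f_S0' f_S1')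
qed

end

section \<open>Consequences of the compact relations\<close>

locale compact_relations = serre_pair scale q x y
  for scale :: "'k::field \<Rightarrow> 'a::ring_1 \<Rightarrow> 'a" (infixr \<open>*s\<close> 75) and q :: 'k and x y :: 'a +
  fixes g :: "nat \<Rightarrow> 'a"
  assumes g_0 [simp]: "g 0 = 1"
    and g_commute: "g i * g j = g j * g i"
    and g_y: "cm (g (Suc k)) y = cc *s cm (qc q ((1 / (q - P)) *s qc q (g k) x) y) y"
    and x_g: "cm x (g (Suc k)) = cc *s cm x (qc q x ((1 / (q - P)) *s qc q y (g k)))"
begin

text \<open>\<open>a 0 k = W\<^sub>-\<^sub>k\<close> and \<open>b 0 k = W\<^sub>k\<^sub>+\<^sub>1\<close>.  Exchanging \<open>q\<close> and its inverse turns \<open>a\<close> into \<open>b\<close>.\<close>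

definition a :: "nat \<Rightarrow> nat \<Rightarrow> 'a" where "a r k = (1 / (q - P)) *s qc q (g k) (e r)"
definition b :: "nat \<Rightarrow> nat \<Rightarrow> 'a" where "b s k = (1 / (q - P)) *s qc q (f s) (g k)"

lemma a_scaled: "(q - P) *s a r k = qc q (g k) (e r)"
  and b_scaled: "(q - P) *s b s k = qc q (f s) (g k)"
  using q_units by (simp_all add: a_def b_def)

lemma a_0: "a r 0 = e r"
  by (rule scale_eqI [of "q - P"]) (use q_units in simp, unfold a_scaled, simp add: expand)

lemma b_0: "b s 0 = f s"
  by (rule scale_eqI [of "q - P"]) (use q_units in simp, unfold b_scaled, simp add: expand)

text \<open>As \<open>q - P\<close> is a unit, \<open>g k\<close> commutes with
  \<open>sg r s\<close> exactly when \<open>cm (e r) (b s k) = cm (a r k) (f s)\<close>.\<close>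

lemma cm_b_a: "(q - P) *s (cm (e r) (b s k) - cm (a r k) (f s)) = cm (sg r s) (g k)"
proof -
  have "(q - P) *s (cm (e r) (b s k) - cm (a r k) (f s))
      = cm (e r) ((q - P) *s b s k) - cm ((q - P) *s a r k) (f s)"
    by (simp add: scale_right_diff_distrib)
  also have "\<dots> = cm (sg r s) (g k)"
    unfolding a_scaled b_scaled by (simp add: sg_def expand algebra_simps)
  finally show ?thesis .
qed

text \<open>Trades the q-bracket in \<open>a r k\<close> for a plain bracket. Once
  \<open>cm (e r) (g (Suc k))\<close> is known to be \<open>a (Suc r) k\<close>, this becomes the
  recursion \<open>a_Suc\<close>.\<close>

lemma a_Suc_aux:
  assumes "cm (e r) (g k) = v"
  shows "(q * q - 1) *s a r k = (q * q - 1) *s (g k * e r) - v"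
proof -
  have "(q * q - 1) *s a r k = q *s (q - P) *s a r k"
    by (simp add: algebra_simps)
  also have "\<dots> = (q * q - 1) *s (g k * e r) - v"
    unfolding a_scaled assms [symmetric] by (simp add: expand)
  finally show ?thesis .
qed

lemma b_Suc_aux:
  assumes "cm (f s) (g k) = v"
  shows "(P * P - 1) *s b s k = (P * P - 1) *s (g k * f s) - v"
proof -
  have "(P * P - 1) *s b s k = - (P *s (q - P) *s b s k)"
    by (simp add: algebra_simps)
  also have "\<dots> = (P * P - 1) *s (g k * f s) - v"
    unfolding b_scaled assms [symmetric] by (simp add: expand)
  finally show ?thesis .
qed

section \<open>Induction on the index of the commuting generators\<close>

text \<open>The statement carried through the induction. At \<open>k = 0\<close> the second clause
  is \<open>sg_Suc\<close>, the last two are \<open>e_e\<close> and \<open>f_f\<close>, and the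
  others are trivial.\<close>

definition level :: "nat \<Rightarrow> bool" where "level k \<longleftrightarrow>
  (\<forall>r s. cm (sg r s) (g k) = 0) \<and>
  (\<forall>r s. qc q (a (Suc r) k) (f s) + qc q (e r) (b (Suc s) k) = 0) \<and>
  (\<forall>r. e r * a r k = a r k * e r) \<and> (\<forall>s. f s * b s k = b s k * f s) \<and>
  (\<forall>r. e r * a (Suc r) k = (q * q) *s (a (Suc r) k * e r)) \<and>
  (\<forall>s. f s * b (Suc s) k = (P * P) *s (b (Suc s) k * f s))"

lemma level_0: "level 0"
  using sg_Suc by (auto simp: level_def a_0 b_0 e_e f_f cm_def sg_def)

lemma level_Suc:
  assumes "level k"
  shows "level (Suc k)" and "cm (e r) (g (Suc k)) = a (Suc r) k" and "cm (f s) (g (Suc k)) = b (Suc s) k"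
proof -
  have C: "cm (sg r s) (g k) = 0"
    and Lam: "qc q (a (Suc r) k) (f s) + qc q (e r) (b (Suc s) k) = 0"
    and La: "e r * a r k = a r k * e r" and Lb: "f s * b s k = b s k * f s"
    and Ha: "e r * a (Suc r) k = (q * q) *s (a (Suc r) k * e r)"
    and Hb: "f s * b (Suc s) k = (P * P) *s (b (Suc s) k * f s)" for r s
    using assms by (simp_all add: level_def)
  have m: "cm (e r) (b s k) = cm (a r k) (f s)" for r s
    using cm_b_a [of r s k] C q_units by simp
  have D_g_0: "D h = 0" if "cm (S 0) h = 0" for h
    using that by (simp add: D_def sg_def cm_def)
  have D_g: "D (g k) = 0"
    using C by (rule D_g_0)
  have D_a: "D (a r k) = a (Suc r) k" and D_b: "D (b s k) = b (Suc s) k" for r s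
    by (simp_all add: a_def b_def D_scale D_qc D_g) (simp_all add: expand)
  \<comment> \<open>By \<open>m\<close> and \<open>La\<close>, the right-hand side of the compact
    relation \<open>x_g\<close> becomes the normalised bracket of \<open>a 0 k\<close> with
    \<open>qc q x y\<close>, that is \<open>D (a 0 k)\<close>.\<close>
  have ag: "cm x (g (Suc k)) = a (Suc 0) k"
  proof -
    have "cm x (g (Suc k)) = cc *s cm x (qc q x (b 0 k))"
      using x_g by (simp add: b_def)
    also have "cm x (qc q x (b 0 k)) = qc q x (cm (e 0) (b 0 k))"
      by (simp add: expand)
    also have "\<dots> = cm (a 0 k) (qc q x y)"
      unfolding m using La [of 0] assoc_rewrite [OF La [of 0]] by (simp add: expand algebra_simps)
    finally show ?thesis
      using D_a [of 0] by (simp add: D_def)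
  qed
  have bg: "cm y (g (Suc k)) = b (Suc 0) k"
  proof -
    have "cm y (g (Suc k)) = - (cc *s cm (qc q (a 0 k) y) y)"
      using g_y [of k] by (simp add: a_def cm_def algebra_simps)
    also have "cm (qc q (a 0 k) y) y = qc q (cm (a 0 k) (f 0)) y"
      by (simp add: expand)
    also have "\<dots> = - cm (b 0 k) (qc q x y)"
      unfolding m [symmetric] using Lb [of 0] assoc_rewrite [OF Lb [of 0]] by (simp add: expand algebra_simps)
    finally show ?thesis
      using D_b [of 0] by (simp add: D_def)
  qed
  have sg_g: "cm (sg r s) (g (Suc k)) = qc q (cm (e r) (g (Suc k))) (f s) + qc q (e r) (cm (f s) (g (Suc k)))" for r s
    by (simp add: sg_def expand algebra_simps)
  \<comment> \<open>By the second clause of \<open>level\<close>. Hence \<open>D\<close> kills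
    \<open>g (Suc k)\<close> and carries its brackets with \<open>x\<close> and \<open>y\<close>
    over to all \<open>e r\<close> and \<open>f s\<close>.\<close>
  have "cm (S 0) (g (Suc k)) = 0"
    using Lam [of 0 0] by (simp add: sg_g ag bg)
  then have D_g': "D (g (Suc k)) = 0"
    by (rule D_g_0)
  show Pa: "cm (e r) (g (Suc k)) = a (Suc r) k" for r
  proof (induction r)
    case (Suc r)
    then show ?case using D_cm [of "e r" "g (Suc k)"] by (simp add: D_g' D_a) (simp add: cm_def)
  qed (simp add: ag)
  show Pb: "cm (f s) (g (Suc k)) = b (Suc s) k" for s
  proof (induction s)
    case (Suc s)
    then show ?case using D_cm [of "f s" "g (Suc k)"] by (simp add: D_g' D_b) (simp add: cm_def)
  qed (simp add: bg)
  have eg: "e r * g (Suc k) = g (Suc k) * e r + a (Suc r) k" for r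
    using Pa [of r] by (simp add: cm_def algebra_simps)
  have fg: "f s * g (Suc k) = g (Suc k) * f s + b (Suc s) k" for s
    using Pb [of s] by (simp add: cm_def algebra_simps)
  note a' = a_Suc_aux [OF Pa] and b' = b_Suc_aux [OF Pb]
  have C': "cm (sg r s) (g (Suc k)) = 0" for r s
    by (simp add: sg_g Pa Pb Lam)
  have Ha': "e (Suc r) * a (Suc r) k + e r * a (Suc (Suc r)) k
      = (q * q) *s (a (Suc (Suc r)) k * e r + a (Suc r) k * e (Suc r))" for r
    using arg_cong [OF Ha [of r], of D] by (simp add: D_mult D_scale D_a)
  have Hb': "f (Suc r) * b (Suc r) k + f r * b (Suc (Suc r)) k
      = (P * P) *s (b (Suc (Suc r)) k * f r + b (Suc r) k * f (Suc r))" for r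
    using arg_cong [OF Hb [of r], of D] by (simp add: D_mult D_scale D_b)
  note step_a = twisted_step [where a = "\<lambda>r. a r k" and a' = "\<lambda>r. a r (Suc k)", OF eg a' e_e La Ha Ha']
  note step_b = q_algebra.twisted_step [OF q_inverse, where a = "\<lambda>r. b r k" and a' = "\<lambda>r. b r (Suc k)",
      OF fg b' f_f Lb Hb Hb']
  \<comment> \<open>After the recursions are inserted, the terms group into instances of
    \<open>sg_Suc\<close>, of the second clause at \<open>k\<close>, and of
    \<open>m\<close>.\<close>
  have Lam': "qc q (a (Suc r) (Suc k)) (f s) + qc q (e r) (b (Suc s) (Suc k)) = 0" for r s
  proof -
    let ?k = "q * q - 1"
    have b'': "?k *s b s (Suc k) = ?k *s (g (Suc k) * f s) + (q * q) *s b (Suc s) k" for s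
    proof -
      have "?k *s b s (Suc k) = - ((q * q) *s (P * P - 1) *s b s (Suc k))"
        by (simp add: algebra_simps)
      then show ?thesis unfolding b' by (simp add: algebra_simps)
    qed
    have "?k *s (qc q (a (Suc r) (Suc k)) (f s) + qc q (e r) (b (Suc s) (Suc k)))
        = qc q (?k *s a (Suc r) (Suc k)) (f s) + qc q (e r) (?k *s b (Suc s) (Suc k))"
      by (simp add: expand algebra_simps)
    also have "\<dots> = ?k *s (g (Suc k) * (sg (Suc r) s + sg r (Suc s)))
        - (qc q (a (Suc (Suc r)) k) (f s) + qc q (e (Suc r)) (b (Suc s) k))
        + (q * q) *s (qc q (a (Suc r) k) (f (Suc s)) + qc q (e r) (b (Suc (Suc s)) k))
        + q *s (cm (e (Suc r)) (b (Suc s) k) - cm (a (Suc r) k) (f (Suc s)))"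
      unfolding a' b''
      by (simp add: expand sg_def eg fg assoc_rewrite [OF eg] assoc_rewrite [OF fg] algebra_simps)
    also have "\<dots> = 0"
      by (simp add: Lam sg_Suc m)
    finally show ?thesis using q_units by simp
  qed
  show "level (Suc k)"
    unfolding level_def using C' Lam' step_a step_b by blast
qed

lemma level: "level k"
  by (induction k) (simp_all add: level_0 level_Suc)

lemma e_g: "cm (e r) (g (Suc k)) = a (Suc r) k"
  and f_g: "cm (f s) (g (Suc k)) = b (Suc s) k"
  using level_Suc level by blast+

lemma e_b: "cm (e r) (b s k) = cm (a r k) (f s)"
  using cm_b_a [of r s k] level [of k] q_units by (simp add: level_def)

lemma a_Suc: "(q * q - 1) *s a r (Suc k) = (q * q - 1) *s (g (Suc k) * e r) - a (Suc r) k"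
  by (rule a_Suc_aux) (rule e_g)

lemma b_Suc_inv: "(P * P - 1) *s b s (Suc k) = (P * P - 1) *s (g (Suc k) * f s) - b (Suc s) k"
  by (rule b_Suc_aux) (rule f_g)

lemma b_Suc: "(q * q - 1) *s b s (Suc k) = (q * q - 1) *s (g (Suc k) * f s) + (q * q) *s b (Suc s) k"
proof -
  have "(q * q - 1) *s b s (Suc k) = - ((q * q) *s (P * P - 1) *s b s (Suc k))"
    by (simp add: algebra_simps)
  then show ?thesis unfolding b_Suc_inv by (simp add: algebra_simps)
qed

section \<open>Brackets symmetric in two indices\<close>

lemma a_g_sym: "cm (a r i) (g (Suc j)) = cm (a r j) (g (Suc i))"
  by (rule bracket_symmetric [where g = g and a = a, OF g_commute e_g a_0 a_Suc])

lemma b_g_sym: "cm (b r i) (g (Suc j)) = cm (b r j) (g (Suc i))"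
  by (rule q_algebra.bracket_symmetric [OF q_inverse, where g = g and a = b, OF g_commute f_g b_0 b_Suc_inv])

text \<open>This is the defect left in the inductive step of \<open>a_b_sym\<close>. The case
  \<open>p = 0\<close> is the second clause of \<open>level\<close>; for the step,
  \<open>a_Suc\<close> lowers the index.\<close>

lemma a_b_shift:
  "cm (a (Suc r) p) (b s j) + (q * q) *s cm (a r p) (b (Suc s) j)
    = - ((q * q - 1) *s (cm (b s j) (g (Suc p)) * e r + cm (a r j) (g (Suc p)) * f s))"
proof (induction p arbitrary: r s)
  case 0
  have 1: "cm (b s j) (g (Suc 0)) = b (Suc s) j" and 2: "cm (a r j) (g (Suc 0)) = a (Suc r) j"
    using b_g_sym [of s j 0] a_g_sym [of r j 0] by (simp_all add: a_0 b_0 e_g f_g)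
  have "cm (a (Suc r) j) (f s) + (q * q) *s cm (e r) (b (Suc s) j)
      + (q * q - 1) *s (b (Suc s) j * e r + a (Suc r) j * f s)
      = q *s (qc q (a (Suc r) j) (f s) + qc q (e r) (b (Suc s) j))"
    by (simp add: expand algebra_simps)
  also have "\<dots> = 0"
    using level [of j] by (simp add: level_def)
  finally show ?case
    by (simp add: a_0 1 2 e_b eq_neg_iff_add_eq_0)
next
  case (Suc p)
  let ?k = "q * q - 1" and ?g = "g (Suc p)"
  let ?a = "a (Suc r) j" and ?b = "b (Suc s) j"
  have base: "cm (e (Suc r)) (b s j) + (q * q) *s cm (e r) ?b = - (?k *s (?b * e r + ?a * f s))"
  proof -
    have "cm (a (Suc r) j) (f s) + (q * q) *s cm (e r) ?b + ?k *s (?b * e r + ?a * f s)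
        = q *s (qc q ?a (f s) + qc q (e r) ?b)"
      by (simp add: expand algebra_simps)
    also have "\<dots> = 0"
      using level [of j] by (simp add: level_def)
    finally show ?thesis
      by (simp add: e_b eq_neg_iff_add_eq_0)
  qed
  \<comment> \<open>Symmetry exchanges \<open>j\<close> with \<open>Suc p\<close>, so that
    \<open>b_Suc\<close> can lower the latter; a second exchange restores \<open>j\<close>.\<close>
  have kb: "?k *s cm (b s j) (g (Suc (Suc p))) = ?k *s (?g * ?b) + (q * q) *s cm ?b ?g"
  proof -
    have "?k *s cm (b s j) (g (Suc (Suc p))) = cm (?k *s b s (Suc p)) (g (Suc j))"
      unfolding b_g_sym [of s j] by simp
    also have "\<dots> = ?k *s (?g * cm (f s) (g (Suc j))) + (q * q) *s cm (b (Suc s) p) (g (Suc j))"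
      unfolding b_Suc by (simp add: expand g_commute [of "Suc j" "Suc p"] assoc_rewrite [OF g_commute [of "Suc j" "Suc p"]])
    finally show ?thesis by (simp add: f_g b_g_sym [of "Suc s" p])
  qed
  have ka: "?k *s cm (a r j) (g (Suc (Suc p))) = ?k *s (?g * ?a) - cm ?a ?g"
  proof -
    have "?k *s cm (a r j) (g (Suc (Suc p))) = cm (?k *s a r (Suc p)) (g (Suc j))"
      unfolding a_g_sym [of r j] by simp
    also have "\<dots> = ?k *s (?g * cm (e r) (g (Suc j))) - cm (a (Suc r) p) (g (Suc j))"
      unfolding a_Suc by (simp add: expand g_commute [of "Suc j" "Suc p"] assoc_rewrite [OF g_commute [of "Suc j" "Suc p"]])
    finally show ?thesis by (simp add: e_g a_g_sym [of "Suc r" p])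
  qed
  have "?k *s (cm (a (Suc r) (Suc p)) (b s j) + (q * q) *s cm (a r (Suc p)) ?b)
      = cm (?k *s a (Suc r) (Suc p)) (b s j) + (q * q) *s cm (?k *s a r (Suc p)) ?b"
    by (simp add: expand algebra_simps)
  also have "\<dots> = ?k *s (?g * (cm (e (Suc r)) (b s j) + (q * q) *s cm (e r) ?b))
      - ?k *s (cm (b s j) ?g * e (Suc r)) - (q * q * ?k) *s (cm ?b ?g * e r)
      - (cm (a (Suc (Suc r)) p) (b s j) + (q * q) *s cm (a (Suc r) p) ?b)"
    unfolding a_Suc by (simp add: expand algebra_simps)
  also have "\<dots> = - (?k *s ((?k *s (?g * ?b) + (q * q) *s cm ?b ?g) * e r
      + (?k *s (?g * ?a) - cm ?a ?g) * f s))"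
    unfolding Suc.IH base by (simp add: expand algebra_simps)
  also have "\<dots> = ?k *s (- (?k *s (cm (b s j) (g (Suc (Suc p))) * e r + cm (a r j) (g (Suc (Suc p))) * f s)))"
    by (simp add: kb [symmetric] ka [symmetric] scale_mult_left scale_right_distrib scale_right_diff_distrib)
  finally show ?case using q_units by (rule_tac scale_eqI)
qed

text \<open>Lowering \<open>Suc p\<close> by both recursions leaves three groups: the first vanishes
  by \<open>e_b\<close>, and the other two cancel by the induction hypothesis at
  \<open>Suc s\<close> and \<open>a_b_shift\<close>.\<close>

lemma a_b_sym: "cm (a r i) (b s j) = cm (a r j) (b s i)"
proof (induction i arbitrary: j r s)
  case 0
  then show ?case by (simp add: a_0 b_0 e_b)
next
  case (Suc p)
  let ?k = "q * q - 1" and ?g = "g (Suc p)"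
  have "?k *s (cm (a r (Suc p)) (b s j) - cm (a r j) (b s (Suc p)))
      = cm (?k *s a r (Suc p)) (b s j) - cm (a r j) (?k *s b s (Suc p))"
    by (simp add: expand algebra_simps)
  also have "\<dots> = ?k *s (?g * (cm (e r) (b s j) - cm (a r j) (f s)))
      - ?k *s (cm (b s j) ?g * e r + cm (a r j) ?g * f s)
      - (cm (a (Suc r) p) (b s j) + (q * q) *s cm (a r j) (b (Suc s) p))"
    unfolding a_Suc b_Suc by (simp add: expand algebra_simps)
  also have "\<dots> = 0"
    by (simp add: e_b Suc.IH [of r "Suc s" j, symmetric] a_b_shift)
  finally show ?case using q_units by simp
qed

text \<open>\<open>G k\<close> below is \<open>G\<^sub>k\<^sub>+\<^sub>1\<close>.\<close>

abbreviation Wm :: "nat \<Rightarrow> 'a" where "Wm k \<equiv> a 0 k"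
abbreviation Wp :: "nat \<Rightarrow> 'a" where "Wp k \<equiv> b 0 k"
definition m :: "nat \<Rightarrow> 'a" where "m k = cm (Wm k) y"
definition G :: "nat \<Rightarrow> 'a" where "G k = g (Suc k) + (1 / (1 - P * P)) *s cm y (Wm k)"

lemma x_Wp: "cm x (Wp k) = m k"
  using e_b [of 0 0 k] by (simp add: m_def)

lemma m_eq: "m k = (1 - P * P) *s (g (Suc k) - G k)"
proof -
  have "(1 - P * P) *s (g (Suc k) - G k) = - cm y (Wm k)"
    using minus_P2 by (simp add: G_def scale_right_distrib)
  then show ?thesis by (simp add: m_def cm_def)
qed

lemma G_scaled: "(1 - P * P) *s G k = (1 - P * P) *s g (Suc k) - m k"
  using m_eq [of k] by (simp add: scale_right_diff_distrib)

lemma Wm_x: "Wm i * x = x * Wm i" and Wp_y: "Wp i * y = y * Wp i"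
proof -
  have "e 0 * a 0 i = a 0 i * e 0" "f 0 * b 0 i = b 0 i * f 0"
    using level [of i] unfolding level_def by blast+
  then show "Wm i * x = x * Wm i" "Wp i * y = y * Wp i" by simp_all
qed

lemma Wm_Wm: "Wm i * Wm j = Wm j * Wm i"
  by (rule twisted_commute [where g = g and ?e0.0 = x and ?a0.0 = Wm, OF a_g_sym])
    (simp_all add: a_scaled a_0 Wm_x)

text \<open>The bracket in \<open>b\<close>, read with \<open>q\<close> inverted and the arguments
  swapped, as \<open>twisted_commute\<close> at \<open>P\<close> expects it.\<close>

lemma b_scaled_inv: "(P - q) *s b s k = P *s (g k * f s) - q *s (f s * g k)"
proof -
  have "(P - q) *s b s k = - ((q - P) *s b s k)" by (simp add: algebra_simps)
  then show ?thesis unfolding b_scaled by (simp add: qc_def)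
qed

lemma Wp_Wp: "Wp i * Wp j = Wp j * Wp i"
proof (rule q_algebra.twisted_commute [OF q_inverse, where g = g and ?e0.0 = y and ?a0.0 = Wp, OF b_g_sym])
  show "Wp i * y = y * Wp i" for i by (rule Wp_y)
  show "(P - inverse P) *s Wp k = qc P (g k) y" for k
    using b_scaled_inv [of 0 k] by (simp add: qc_def)
qed (simp add: b_0)

lemma qc_g_x: "qc q (g k) x = (q - P) *s Wm k" and qc_y_g: "qc q y (g k) = (q - P) *s Wp k"
  by (simp_all add: a_scaled b_scaled)

section \<open>Relations involving G\<close>

lemma x_g_m: "(q - P * (P * P)) *s cm x (g (Suc k)) = qc q x (m k)"
proof -
  have "(q - P * (P * P)) *s cm x (g (Suc k)) = cm x (qc q x (Wp k))"
    using x_g [of k] by (simp add: b_def cc_inverse)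
  also have "\<dots> = qc q x (m k)"
    by (simp add: expand flip: x_Wp)
  finally show ?thesis .
qed

lemma g_y_m: "(q - P * (P * P)) *s cm (g (Suc k)) y = qc q (m k) y"
proof -
  have "(q - P * (P * P)) *s cm (g (Suc k)) y = cm (qc q (Wm k) y) y"
    using g_y [of k] by (simp add: a_def cc_inverse)
  also have "\<dots> = qc q (m k) y"
    by (simp add: expand m_def)
  finally show ?thesis .
qed

lemma qc_x_G: "qc q x (G k) = qc q (g (Suc k)) x"
proof -
  have "(1 - P * P) *s (qc q x (G k) - qc q (g (Suc k)) x)
      = qc q x ((1 - P * P) *s G k) - (1 - P * P) *s qc q (g (Suc k)) x"
    by (simp add: expand algebra_simps)
  also have "\<dots> = (q - P * (P * P)) *s cm x (g (Suc k)) - qc q x (m k)"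
    unfolding G_scaled by (simp add: expand algebra_simps)
  also have "\<dots> = 0" by (simp add: x_g_m)
  finally show ?thesis using minus_P2 by simp
qed

lemma qc_G_y: "qc q (G k) y = qc q y (g (Suc k))"
proof -
  have "(1 - P * P) *s (qc q (G k) y - qc q y (g (Suc k)))
      = qc q ((1 - P * P) *s G k) y - (1 - P * P) *s qc q y (g (Suc k))"
    by (simp add: expand algebra_simps)
  also have "\<dots> = (q - P * (P * P)) *s cm (g (Suc k)) y - qc q (m k) y"
    unfolding G_scaled by (simp add: expand algebra_simps)
  also have "\<dots> = 0" by (simp add: g_y_m)
  finally show ?thesis using minus_P2 by simp
qed

text \<open>By \<open>a_b_sym\<close>, \<open>Wm (Suc i)\<close> against \<open>Wp j\<close> equals
  \<open>Wm j\<close> against \<open>Wp (Suc i)\<close>. Expanding both through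
  \<open>g (Suc i)\<close> expresses the bracket with \<open>m j\<close> by brackets already known
  to be symmetric.\<close>

lemma m_g_sym: "cm (m i) (g (Suc j)) = cm (m j) (g (Suc i))"
proof -
  have formula: "(q + P) *s cm (g (Suc i)) (m j)
      = qc q y (cm (Wm j) (g (Suc i))) + qc q (cm (Wp j) (g (Suc i))) x" for i j
  proof -
    have "cm (qc q (g (Suc i)) x) (Wp j) = (q - P) *s cm (Wm (Suc i)) (Wp j)"
      unfolding qc_g_x by (simp add: expand algebra_simps)
    also have "\<dots> = (q - P) *s cm (Wm j) (Wp (Suc i))"
      by (simp add: a_b_sym)
    also have "\<dots> = cm (Wm j) (qc q y (g (Suc i)))"
      unfolding qc_y_g by (simp add: expand algebra_simps)
    finally have eq: "cm (qc q (g (Suc i)) x) (Wp j) = cm (Wm j) (qc q y (g (Suc i)))" .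
    have 1: "cm (qc q (g (Suc i)) x) (Wp j) = qc q (g (Suc i)) (cm x (Wp j)) - qc q (cm (Wp j) (g (Suc i))) x"
      by (simp add: expand algebra_simps)
    have 2: "cm (Wm j) (qc q y (g (Suc i))) = qc q (cm (Wm j) y) (g (Suc i)) + qc q y (cm (Wm j) (g (Suc i)))"
      by (simp add: expand algebra_simps)
    have "(q + P) *s cm (g (Suc i)) (m j) = qc q (g (Suc i)) (m j) - qc q (m j) (g (Suc i))"
      by (simp add: expand algebra_simps)
    then show ?thesis
      using eq unfolding 1 2 x_Wp m_def [symmetric] by (simp add: algebra_simps)
  qed
  have "(q + P) *s cm (g (Suc i)) (m j) = (q + P) *s cm (g (Suc j)) (m i)"
    unfolding formula by (simp add: a_g_sym [of 0 j] b_g_sym [of 0 j])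
  then have "cm (g (Suc i)) (m j) = cm (g (Suc j)) (m i)"
    using q_units by simp
  then show ?thesis by (simp add: cm_def algebra_simps)
qed

text \<open>\<open>Wm k\<close> commutes with \<open>x\<close> and \<open>m l = cm x (Wp l)\<close>,
  so the bracket is that of \<open>x\<close> with \<open>cm (Wm k) (Wp l)\<close>, symmetric by
  \<open>a_b_sym\<close>.\<close>

lemma Wm_m: "cm (Wm k) (m l) = cm (Wm l) (m k)"
proof -
  have "cm (Wm k) (m l) = cm x (cm (Wm k) (Wp l))" for k l
    using Wm_x [of k] assoc_rewrite [OF Wm_x [of k]] by (simp add: expand flip: x_Wp)
  then show ?thesis by (simp add: a_b_sym [of 0 k])
qed

lemma Wp_m: "cm (Wp k) (m l) = cm (Wp l) (m k)"
proof -
  have "cm (Wp k) (m l) = - cm (cm (Wm l) (Wp k)) y" for k l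
    using Wp_y [of k] assoc_rewrite [OF Wp_y [of k]] by (simp add: expand m_def)
  then show ?thesis by (simp add: a_b_sym [of 0 k])
qed

lemma Wm_G: "cm (Wm k) (G l) = cm (Wm l) (G k)" and Wp_G: "cm (Wp k) (G l) = cm (Wp l) (G k)"
proof -
  have sc: "(1 - P * P) *s cm u (G l) = (1 - P * P) *s cm u (g (Suc l)) - cm u (m l)" for u l
  proof -
    have "(1 - P * P) *s cm u (G l) = cm u ((1 - P * P) *s G l)"
      by (simp add: expand)
    then show ?thesis unfolding G_scaled by (simp add: expand)
  qed
  have "(1 - P * P) *s cm (Wm k) (G l) = (1 - P * P) *s cm (Wm l) (G k)"
    unfolding sc by (simp add: a_g_sym [of 0 k] Wm_m [of k])
  then show "cm (Wm k) (G l) = cm (Wm l) (G k)" using minus_P2 by simp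
  have "(1 - P * P) *s cm (Wp k) (G l) = (1 - P * P) *s cm (Wp l) (G k)"
    unfolding sc by (simp add: b_g_sym [of 0 k] Wp_m [of k])
  then show "cm (Wp k) (G l) = cm (Wp l) (G k)" using minus_P2 by simp
qed

lemma Wm_G_y: "(q - P) *s cm (Wm i) (Wp (Suc j)) = qc q (cm (Wm i) (G j)) y + qc q (G j) (m i)"
proof -
  have "(q - P) *s cm (Wm i) (Wp (Suc j)) = cm (Wm i) ((q - P) *s Wp (Suc j))"
    by simp
  then show ?thesis
    unfolding qc_y_g [symmetric] qc_G_y [symmetric] by (simp add: expand m_def)
qed

lemma x_G_Wp: "(q - P) *s cm (Wm (Suc j)) (Wp i) = qc q x (cm (G j) (Wp i)) + qc q (m i) (G j)"
proof -
  have "(q - P) *s cm (Wm (Suc j)) (Wp i) = cm ((q - P) *s Wm (Suc j)) (Wp i)"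
    by simp
  then show ?thesis
    unfolding qc_g_x [symmetric] qc_x_G [symmetric] by (simp add: expand flip: x_Wp)
qed

text \<open>The argument of \<open>m_g_sym\<close> with \<open>Wm (Suc j)\<close> and
  \<open>Wp (Suc j)\<close> expressed through \<open>G j\<close> instead of
  \<open>g (Suc j)\<close>.\<close>

lemma m_G_sym: "cm (m i) (G j) = cm (m j) (G i)"
proof -
  have formula: "(q + P) *s cm (m i) (G j) = qc q (cm (Wm i) (G j)) y + qc q x (cm (Wp i) (G j))" for i j
  proof -
    have "(q + P) *s cm (m i) (G j) = qc q (m i) (G j) - qc q (G j) (m i)"
      by (simp add: expand algebra_simps)
    also have "\<dots> = qc q (cm (Wm i) (G j)) y - qc q x (cm (G j) (Wp i))"
      using Wm_G_y [of i j] x_G_Wp [of j i] by (simp add: a_b_sym [of 0 "Suc j"] algebra_simps)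
    also have "qc q x (cm (G j) (Wp i)) = - qc q x (cm (Wp i) (G j))"
      by (simp add: expand)
    finally show ?thesis by simp
  qed
  have "(q + P) *s cm (m i) (G j) = (q + P) *s cm (m j) (G i)"
    unfolding formula by (simp add: Wm_G [of i] Wp_G [of i])
  then show ?thesis using q_units by simp
qed

text \<open>
  Both \<open>[m\<^sub>i, g\<^sub>j\<^sub>+\<^sub>1]\<close> and \<open>[m\<^sub>i, G\<^sub>j\<^sub>+\<^sub>1]\<close> are symmetric.  Adding the two symmetric expressions, rather than
  subtracting the commutators, avoids a factor \<open>2\<close> and so covers characteristic 2.
\<close>

lemma m_m: "m i * m j = m j * m i"
proof -
  let ?M = "\<lambda>i j. cm (Wm i) (Wp (Suc j))"
  have 1: "(1 - P * P) *s (?M i j - g (Suc j) * m i)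
      = cm (m i) (g (Suc j)) - (P * P) *s (cm (Wm i) (g (Suc j)) * y) + y * cm (Wm i) (g (Suc j))" for i j
  proof -
    have "(q - P) *s ?M i j = cm (Wm i) ((q - P) *s Wp (Suc j))"
      by simp
    also have "\<dots> = qc q (m i) (g (Suc j)) + qc q y (cm (Wm i) (g (Suc j)))"
      unfolding qc_y_g [symmetric] by (simp add: expand m_def)
    finally have "P *s (q - P) *s ?M i j = P *s (qc q (m i) (g (Suc j)) + qc q y (cm (Wm i) (g (Suc j))))"
      by simp
    moreover have "(1 - P * P) *s ?M i j = P *s (q - P) *s ?M i j"
      by (simp add: algebra_simps)
    ultimately have "(1 - P * P) *s ?M i j = P *s (qc q (m i) (g (Suc j)) + qc q y (cm (Wm i) (g (Suc j))))"
      by simp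
    then show ?thesis
      unfolding scale_right_diff_distrib by (simp add: expand algebra_simps)
  qed
  have 2: "(q * q - 1) *s (G j * m i - ?M i j)
      = cm (m i) (G j) - (q * q) *s (cm (Wm i) (G j) * y) + y * cm (Wm i) (G j)" for i j
  proof -
    have "(q * q - 1) *s ?M i j = q *s (q - P) *s ?M i j"
      by (simp add: algebra_simps)
    then show ?thesis
      unfolding Wm_G_y scale_right_diff_distrib [of _ _ "?M i j"] by (simp add: expand algebra_simps)
  qed
  have "(1 - P * P) *s (?M i j - g (Suc j) * m i) = (1 - P * P) *s (?M j i - g (Suc i) * m j)"
    unfolding 1 by (simp add: m_g_sym [of i] a_g_sym [of 0 i])
  then have eq1: "?M i j - g (Suc j) * m i = ?M j i - g (Suc i) * m j"
    using minus_P2 by simp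
  have "(q * q - 1) *s (G j * m i - ?M i j) = (q * q - 1) *s (G i * m j - ?M j i)"
    unfolding 2 by (simp add: m_G_sym [of i] Wm_G [of i])
  then have eq2: "G j * m i - ?M i j = G i * m j - ?M j i"
    using q_units by simp
  \<comment> \<open>The \<open>?M\<close> terms cancel in the sum, and
    \<open>g (Suc j) - G j\<close> is \<open>m j\<close> up to a unit.\<close>
  have "(g (Suc j) - G j) * m i = (g (Suc i) - G i) * m j"
    using arg_cong2 [OF eq1 eq2, of "(+)"] by (simp add: algebra_simps)
  then have "((1 - P * P) *s (g (Suc j) - G j)) * m i = ((1 - P * P) *s (g (Suc i) - G i)) * m j"
    by (simp add: scale_mult_left)
  then show ?thesis by (simp add: m_eq [symmetric])
qed

lemma g_G_sym: "cm (g (Suc i)) (G j) = cm (g (Suc j)) (G i)"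
proof -
  have "(1 - P * P) *s cm (g (Suc i)) (G j) = cm (m j) (g (Suc i))" for i j
  proof -
    have "(1 - P * P) *s cm (g (Suc i)) (G j) = cm (g (Suc i)) ((1 - P * P) *s G j)"
      by (simp add: expand)
    then show ?thesis unfolding G_scaled by (simp add: expand g_commute [of "Suc i"])
  qed
  then have "(1 - P * P) *s cm (g (Suc i)) (G j) = (1 - P * P) *s cm (g (Suc j)) (G i)"
    by (simp add: m_g_sym [of i])
  then show ?thesis using minus_P2 by simp
qed

text \<open>\<open>G\<close> is a combination of \<open>g\<close> and \<open>m\<close>, each a
  commuting family by \<open>g_commute\<close> and \<open>m_m\<close>; the cross terms cancel by
  \<open>m_g_sym\<close>.\<close>

lemma G_G: "G i * G j = G j * G i"
proof -
  have "(1 - P * P) *s (1 - P * P) *s cm (G i) (G j) = cm ((1 - P * P) *s G i) ((1 - P * P) *s G j)"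
    by (simp add: expand algebra_simps)
  also have "\<dots> = (1 - P * P) *s (cm (m j) (g (Suc i)) - cm (m i) (g (Suc j)))"
    unfolding G_scaled by (simp add: expand g_commute [of "Suc i"] m_m [of i] algebra_simps)
  also have "\<dots> = 0"
    by (simp add: m_g_sym [of i])
  finally show ?thesis using minus_P2 by (simp add: cm_def)
qed

end

section \<open>Free algebras and their ideals\<close>

lemma poly_mapping_single_induct [case_names zero add]:
  fixes p :: "'a \<Rightarrow>\<^sub>0 'b::comm_monoid_add"
  assumes "Q 0" and "\<And>w c p. Q p \<Longrightarrow> Q (Poly_Mapping.single w c + p)"
  shows "Q p"
proof (induction p rule: update_induct)
  case (update p w c)
  have "Poly_Mapping.update w c p = Poly_Mapping.single w c + p"
    using update.hyps(1) by (intro poly_mapping_eqI)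
      (auto simp: lookup_update lookup_add lookup_single in_keys_iff when_def)
  then show ?case using assms(2) [OF update.IH] by simp
qed (use assms in simp)

section \<open>Evaluation of noncommutative polynomials\<close>

abbreviation scalar :: "'k::field \<Rightarrow> 'g word \<Rightarrow>\<^sub>0 'k" where
  "scalar c \<equiv> Poly_Mapping.single 0 c"

lemma scalar_add: "scalar (c + d) = scalar c + scalar d"
  and scalar_mult: "scalar (c * d) = scalar c * scalar d"
  by (simp_all add: Poly_Mapping.single_add Poly_Mapping.mult_single)

lemma scalar_central: "p * scalar c = scalar c * p"
  by (induction p rule: poly_mapping_single_induct)
    (simp_all add: distrib_left distrib_right Poly_Mapping.mult_single mult.commute)

lemma scalar_left_commute: "p * (scalar c * p') = scalar c * (p * p')"
  by (metis mult.assoc scalar_central)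

definition word_eval :: "('g \<Rightarrow> 'h word \<Rightarrow>\<^sub>0 'k::field) \<Rightarrow> 'g word \<Rightarrow> 'h word \<Rightarrow>\<^sub>0 'k" where
  "word_eval \<rho> w = prod_list (map \<rho> (letters w))"

text \<open>The algebra homomorphism given by the universal property of the free algebra.\<close>

definition free_eval :: "('g \<Rightarrow> 'h word \<Rightarrow>\<^sub>0 'k::field) \<Rightarrow> ('g word \<Rightarrow>\<^sub>0 'k) \<Rightarrow> 'h word \<Rightarrow>\<^sub>0 'k" where
  "free_eval \<rho> p = (\<Sum>w\<in>Poly_Mapping.keys p. scalar (Poly_Mapping.lookup p w) * word_eval \<rho> w)"

lemma free_eval_0 [simp]: "free_eval \<rho> 0 = 0"
  by (simp add: free_eval_def)

lemma free_eval_single: "free_eval \<rho> (Poly_Mapping.single w c) = scalar c * word_eval \<rho> w"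
  by (simp add: free_eval_def)

lemma free_eval_add: "free_eval \<rho> (p + p') = free_eval \<rho> p + free_eval \<rho> p'"
  unfolding free_eval_def
  by (rule setsum_keys_plus_distrib [where f = "\<lambda>w c. scalar c * word_eval \<rho> w"]) (simp_all add: scalar_add distrib_right)

lemma free_eval_uminus: "free_eval \<rho> (- p) = - free_eval \<rho> p"
  using free_eval_add [of \<rho> p "- p"] by (simp add: eq_neg_iff_add_eq_0 add.commute)

lemma free_eval_diff: "free_eval \<rho> (p - p') = free_eval \<rho> p - free_eval \<rho> p'"
  using free_eval_add [of \<rho> p "- p'"] by (simp add: free_eval_uminus)

lemma free_eval_single_mult:
  "free_eval \<rho> (Poly_Mapping.single w c * p) = free_eval \<rho> (Poly_Mapping.single w c) * free_eval \<rho> p"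
proof (induction p rule: poly_mapping_single_induct)
  case (add w' d p)
  have "word_eval \<rho> (w + w') = word_eval \<rho> w * word_eval \<rho> w'"
    by (simp add: word_eval_def plus_word_def)
  then have "free_eval \<rho> (Poly_Mapping.single w c * Poly_Mapping.single w' d)
      = free_eval \<rho> (Poly_Mapping.single w c) * free_eval \<rho> (Poly_Mapping.single w' d)"
    unfolding Poly_Mapping.mult_single free_eval_single
    by (simp add: scalar_mult mult.assoc scalar_left_commute [of "word_eval \<rho> w" d])
  with add show ?case by (simp add: distrib_left free_eval_add)
qed simp

lemma free_eval_mult: "free_eval \<rho> (p * p') = free_eval \<rho> p * free_eval \<rho> p'"
  by (induction p rule: poly_mapping_single_induct)
    (simp_all add: distrib_right free_eval_add free_eval_single_mult)

lemma free_eval_scalar [simp]: "free_eval \<rho> (scalar c) = scalar c"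
  by (simp add: free_eval_single word_eval_def zero_word_def)

lemma free_eval_1 [simp]: "free_eval \<rho> 1 = 1"
  using free_eval_scalar [of \<rho> 1] by simp

lemma free_eval_gen [simp]: "free_eval \<rho> (free_gen g) = \<rho> g"
  by (simp add: free_gen_def free_eval_single word_eval_def)

lemma Word_Cons: "Poly_Mapping.single (Word (g # gs)) c = free_gen g * Poly_Mapping.single (Word gs) (c::'k::field)"
  by (simp add: free_gen_def Poly_Mapping.mult_single plus_word_def)

lemma free_algebra_induct [case_names scalar gen add]:
  fixes p :: "'g word \<Rightarrow>\<^sub>0 'k::field"
  assumes "\<And>c. Q (scalar c)" and "\<And>g p. Q p \<Longrightarrow> Q (free_gen g * p)"
    and "\<And>p p'. Q p \<Longrightarrow> Q p' \<Longrightarrow> Q (p + p')"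
  shows "Q p"
proof (induction p rule: poly_mapping_single_induct)
  case zero
  then show ?case using assms(1) [of 0] by simp
next
  case (add w c p)
  have "Q (Poly_Mapping.single (Word gs) c)" for gs
  proof (induction gs)
    case Nil
    then show ?case using assms(1) [of c] by (simp add: zero_word_def)
  qed (simp add: Word_Cons assms(2))
  from assms(3) [OF this add] show ?case by (cases w) simp
qed

section \<open>Two-sided ideals and cosets\<close>

definition two_sided_ideal :: "'a::ring_1 set \<Rightarrow> bool" where
  "two_sided_ideal I \<longleftrightarrow> 0 \<in> I \<and> (\<forall>u\<in>I. \<forall>v\<in>I. u + v \<in> I) \<and> (\<forall>u\<in>I. \<forall>r. r * u \<in> I \<and> u * r \<in> I)"

lemma two_sided_idealD:
  assumes "two_sided_ideal I"
  shows "0 \<in> I" "u \<in> I \<Longrightarrow> v \<in> I \<Longrightarrow> u + v \<in> I" "u \<in> I \<Longrightarrow> r * u \<in> I" "u \<in> I \<Longrightarrow> u * r \<in> I"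
    "u \<in> I \<Longrightarrow> - u \<in> I" "u \<in> I \<Longrightarrow> v \<in> I \<Longrightarrow> u - v \<in> I"
proof -
  show m: "- u \<in> I" if "u \<in> I" for u
  proof -
    have "- 1 * u \<in> I" using assms that unfolding two_sided_ideal_def by blast
    then show ?thesis by simp
  qed
  show "u - v \<in> I" if "u \<in> I" "v \<in> I"
  proof -
    have "u + - v \<in> I" using assms m [OF that(2)] that(1) unfolding two_sided_ideal_def by blast
    then show ?thesis by simp
  qed
qed (use assms in \<open>auto simp: two_sided_ideal_def\<close>)

lemma free_algebra_minus: "u \<ominus>\<^bsub>free_algebra\<^esub> v = u - v"
proof -
  interpret ring "free_algebra :: ('b, 'a word \<Rightarrow>\<^sub>0 'b) module" by (rule ring_free_algebra)
  have "\<ominus>\<^bsub>free_algebra\<^esub> v = - v" by (rule minus_equality) simp_all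
  then show ?thesis by (simp add: a_minus_def)
qed

lemma two_sided_ideal_iff: "ideal I free_algebra \<longleftrightarrow> two_sided_ideal I"
proof
  assume "ideal I (free_algebra :: ('b, 'a word \<Rightarrow>\<^sub>0 'b) module)"
  then interpret ideal I "free_algebra :: ('b, 'a word \<Rightarrow>\<^sub>0 'b) module" .
  show "two_sided_ideal I"
    unfolding two_sided_ideal_def
    using zero_closed a_closed I_l_closed I_r_closed additive_subgroup.zero_closed [OF is_additive_subgroup]
      additive_subgroup.a_closed [OF is_additive_subgroup] by simp
next
  assume I: "two_sided_ideal I"
  note D = two_sided_idealD [OF I]
  have inv: "inv\<^bsub>add_monoid free_algebra\<^esub> u = - u" for u :: "'a word \<Rightarrow>\<^sub>0 'b"
  proof -
    interpret ring "free_algebra :: ('b, 'a word \<Rightarrow>\<^sub>0 'b) module" by (rule ring_free_algebra)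
    have "\<ominus>\<^bsub>free_algebra\<^esub> u = - u" by (rule minus_equality) simp_all
    then show ?thesis by (simp add: a_inv_def)
  qed
  show "ideal I free_algebra"
  proof (rule idealI [OF ring_free_algebra])
    show "subgroup I (add_monoid free_algebra)"
      by unfold_locales (use D inv in auto)
  qed (use D in simp_all)
qed

lemma two_sided_relation_ideal: "two_sided_ideal (relation_ideal R)"
  using ideal_relation_ideal [of R] by (simp add: two_sided_ideal_iff)

lemma relation_in_ideal: "(l, r) \<in> R \<Longrightarrow> l - r \<in> relation_ideal R"
  unfolding relation_ideal_def free_algebra_minus
  by (rule subsetD [OF ring.genideal_self [OF ring_free_algebra]]) auto

lemma relation_ideal_minimal:
  assumes "two_sided_ideal I" and "\<And>l r. (l, r) \<in> R \<Longrightarrow> l - r \<in> I"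
  shows "relation_ideal R \<subseteq> I"
  unfolding relation_ideal_def free_algebra_minus
  by (rule ring.genideal_minimal [OF ring_free_algebra]) (use assms two_sided_ideal_iff in auto)

lemma coset_eq_iff:
  "relation_ideal R +>\<^bsub>free_algebra\<^esub> u = relation_ideal R +>\<^bsub>free_algebra\<^esub> v \<longleftrightarrow> u - v \<in> relation_ideal R"
  using ring.quotient_eq_iff_same_a_r_cos [OF ring_free_algebra ideal_relation_ideal, of u v R]
  by (simp add: free_algebra_minus)

lemma two_sided_ideal_vimage:
  assumes "two_sided_ideal I"
  shows "two_sided_ideal {p. free_eval \<rho> p \<in> I}"
  using two_sided_idealD [OF assms]
  by (simp add: two_sided_ideal_def free_eval_add free_eval_mult)

text \<open>The preimage of an ideal under \<open>free_eval\<close> is an ideal, so it suffices to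
  check the generating relations.\<close>

lemma free_eval_relation_ideal:
  assumes "p \<in> relation_ideal R"
    and "\<And>l r. (l, r) \<in> R \<Longrightarrow> free_eval \<rho> l - free_eval \<rho> r \<in> relation_ideal R'"
  shows "free_eval \<rho> p \<in> relation_ideal R'"
  using relation_ideal_minimal [OF two_sided_ideal_vimage [OF two_sided_relation_ideal], of R \<rho> R'] assms
  by (auto simp: free_eval_diff)

lemma free_eval_inverse_mod:
  assumes gen: "\<And>g. free_eval \<sigma> (\<rho> g) - free_gen g \<in> relation_ideal R"
  shows "free_eval \<sigma> (free_eval \<rho> p) - p \<in> relation_ideal R"
proof (induction p rule: free_algebra_induct)
  note D = two_sided_idealD [OF two_sided_relation_ideal [of R]]
  case (scalar c)
  then show ?case using D(1) by simp
next
  note D = two_sided_idealD [OF two_sided_relation_ideal [of R]]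
  case (gen g p)
  have "(free_eval \<sigma> (\<rho> g) - free_gen g) * free_eval \<sigma> (free_eval \<rho> p)
    + free_gen g * (free_eval \<sigma> (free_eval \<rho> p) - p) \<in> relation_ideal R"
    by (intro D(2) D(3) D(4) assms gen)
  then show ?case by (simp add: free_eval_mult algebra_simps)
next
  note D = two_sided_idealD [OF two_sided_relation_ideal [of R]]
  case (add p p')
  from D(2) [OF this] show ?case by (simp add: free_eval_add algebra_simps)
qed

section \<open>Isomorphisms of presented algebras\<close>

lemma carrier_presented_algebra:
  "carrier (presented_algebra R) = range (\<lambda>x. relation_ideal R +>\<^bsub>free_algebra\<^esub> x)"
  by (auto simp: presented_algebra_def quotient_algebra_simps FactRing_def A_RCOSETS_def')

lemma presented_algebra_iso:
  fixes R :: "(('g word \<Rightarrow>\<^sub>0 'k::field) \<times> ('g word \<Rightarrow>\<^sub>0 'k)) set"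
    and R' :: "(('h word \<Rightarrow>\<^sub>0 'k) \<times> ('h word \<Rightarrow>\<^sub>0 'k)) set"
  assumes \<rho>: "\<And>l r. (l, r) \<in> R \<Longrightarrow> free_eval \<rho> l - free_eval \<rho> r \<in> relation_ideal R'"
    and \<sigma>: "\<And>l r. (l, r) \<in> R' \<Longrightarrow> free_eval \<sigma> l - free_eval \<sigma> r \<in> relation_ideal R"
    and \<sigma>\<rho>: "\<And>g. free_eval \<sigma> (\<rho> g) - free_gen g \<in> relation_ideal R"
    and \<rho>\<sigma>: "\<And>h. free_eval \<rho> (\<sigma> h) - free_gen h \<in> relation_ideal R'"
  shows "\<exists>\<phi> \<in> algebra_iso (presented_algebra R) (presented_algebra R').
    \<forall>g. \<phi> (presented_gen R g) = relation_ideal R' +>\<^bsub>free_algebra\<^esub> \<rho> g"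
proof -
  let ?\<pi> = "\<lambda>x. relation_ideal R +>\<^bsub>free_algebra\<^esub> x"
  let ?\<pi>' = "\<lambda>x. relation_ideal R' +>\<^bsub>free_algebra\<^esub> x"
  \<comment> \<open>The map evaluates an arbitrary representative of the coset; the next claim shows
    independence of the choice.\<close>
  define \<phi> where "\<phi> X = ?\<pi>' (free_eval \<rho> (SOME x. X = ?\<pi> x))" for X
  have \<phi>: "\<phi> (?\<pi> x) = ?\<pi>' (free_eval \<rho> x)" for x
  proof -
    define y where "y = (SOME y. ?\<pi> x = ?\<pi> y)"
    have "?\<pi> x = ?\<pi> y" unfolding y_def by (rule someI) (rule refl)
    then have "x - y \<in> relation_ideal R" by (rule coset_eq_iff [THEN iffD1])
    then have "free_eval \<rho> (x - y) \<in> relation_ideal R'"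
      by (rule free_eval_relation_ideal) (rule \<rho>)
    then have "?\<pi>' (free_eval \<rho> x) = ?\<pi>' (free_eval \<rho> y)"
      unfolding free_eval_diff by (rule coset_eq_iff [THEN iffD2])
    then show ?thesis
      by (simp add: \<phi>_def y_def)
  qed
  have "inj_on \<phi> (carrier (presented_algebra R))"
  proof (rule inj_onI)
    fix X Y assume "X \<in> carrier (presented_algebra R)" "Y \<in> carrier (presented_algebra R)" and eq: "\<phi> X = \<phi> Y"
    then obtain x y where X: "X = ?\<pi> x" and Y: "Y = ?\<pi> y" by (auto simp: carrier_presented_algebra)
    have "free_eval \<rho> (x - y) \<in> relation_ideal R'"
      using eq by (simp add: X Y \<phi> coset_eq_iff free_eval_diff)
    then have "free_eval \<sigma> (free_eval \<rho> (x - y)) \<in> relation_ideal R"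
      by (rule free_eval_relation_ideal) (rule \<sigma>)
    from two_sided_idealD(6) [OF two_sided_relation_ideal this free_eval_inverse_mod [OF \<sigma>\<rho>, of "x - y"]]
    show "X = Y" by (simp add: X Y coset_eq_iff)
  qed
  moreover have "\<phi> ` carrier (presented_algebra R) = carrier (presented_algebra R')"
  proof -
    have "?\<pi>' y = ?\<pi>' (free_eval \<rho> (free_eval \<sigma> y))" for y
      using coset_eq_iff [of R' "free_eval \<rho> (free_eval \<sigma> y)" y] free_eval_inverse_mod [OF \<rho>\<sigma>, of y] by simp
    then show ?thesis
      unfolding carrier_presented_algebra image_image \<phi> by blast
  qed
  ultimately have "bij_betw \<phi> (carrier (presented_algebra R)) (carrier (presented_algebra R'))"
    by (simp add: bij_betw_def)
  then have "\<phi> \<in> algebra_iso (presented_algebra R) (presented_algebra R')"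
    by (auto simp: algebra_iso_def ring_iso_def ring_hom_def carrier_presented_algebra
      presented_algebra_coset \<phi> free_eval_mult free_eval_add)
  then show ?thesis
    by (rule rev_bexI) (simp add: presented_gen_def \<phi>)
qed

section \<open>The product of all quotients of a ring\<close>

lemma ideal_congruence:
  assumes I: "two_sided_ideal I" and u: "u - u' \<in> I" and v: "v - v' \<in> I"
  shows "u + v - (u' + v') \<in> I" "u - v - (u' - v') \<in> I" "u * v - u' * v' \<in> I"
proof -
  note D = two_sided_idealD [OF I]
  show "u + v - (u' + v') \<in> I"
    using D(2) [OF u v] by (simp add: algebra_simps)
  show "u - v - (u' - v') \<in> I"
    using D(6) [OF u v] by (simp add: algebra_simps)
  have "(u - u') * v + u' * (v - v') \<in> I"
    by (intro D u v)
  then show "u * v - u' * v' \<in> I"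
    by (simp add: algebra_simps)
qed

lemma ideal_congruence_uminus: "two_sided_ideal I \<Longrightarrow> u - u' \<in> I \<Longrightarrow> u' - u \<in> I"
  using two_sided_idealD(5) [of I "u - u'"] by simp

text \<open>
  A quotient by one ideal that depends on \<open>q\<close> cannot be a type.  The product of the quotients by all
  two-sided ideals can; \<open>residue I\<close> below embeds the quotient by \<open>I\<close> into it (non-unitally).  So
  relations modulo an ideal become equations in a ring of class \<^class>\<open>ring_1\<close>.
\<close>

quotient_type (overloaded) 'a ideal_quotients = "'a::ring_1 set \<Rightarrow> 'a" /
  "\<lambda>u v. \<forall>I. two_sided_ideal I \<longrightarrow> u I - v I \<in> I"
proof (rule equivpI)
  show "reflp (\<lambda>u v :: 'a set \<Rightarrow> 'a. \<forall>I. two_sided_ideal I \<longrightarrow> u I - v I \<in> I)"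
    by (rule reflpI) (simp add: two_sided_idealD)
  show "symp (\<lambda>u v :: 'a set \<Rightarrow> 'a. \<forall>I. two_sided_ideal I \<longrightarrow> u I - v I \<in> I)"
    by (rule sympI) (simp add: ideal_congruence_uminus)
  show "transp (\<lambda>u v :: 'a set \<Rightarrow> 'a. \<forall>I. two_sided_ideal I \<longrightarrow> u I - v I \<in> I)"
  proof (rule transpI, intro allI impI)
    fix u v w :: "'a set \<Rightarrow> 'a" and I :: "'a set"
    assume "\<forall>I. two_sided_ideal I \<longrightarrow> u I - v I \<in> I" "\<forall>I. two_sided_ideal I \<longrightarrow> v I - w I \<in> I"
      and I: "two_sided_ideal I"
    then have "(u I - v I) + (v I - w I) \<in> I"
      by (intro two_sided_idealD(2)) auto
    then show "u I - w I \<in> I" by simp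
  qed
qed

instantiation ideal_quotients :: (ring_1) ring_1
begin

lift_definition zero_ideal_quotients :: "'a ideal_quotients" is "\<lambda>_. 0" .
lift_definition one_ideal_quotients :: "'a ideal_quotients" is "\<lambda>_. 1" .
lift_definition plus_ideal_quotients :: "'a ideal_quotients \<Rightarrow> 'a ideal_quotients \<Rightarrow> 'a ideal_quotients"
  is "\<lambda>u v I. u I + v I"
  by (simp add: ideal_congruence)
lift_definition uminus_ideal_quotients :: "'a ideal_quotients \<Rightarrow> 'a ideal_quotients"
  is "\<lambda>u I. - u I"
  by (simp add: ideal_congruence_uminus)
lift_definition minus_ideal_quotients :: "'a ideal_quotients \<Rightarrow> 'a ideal_quotients \<Rightarrow> 'a ideal_quotients"
  is "\<lambda>u v I. u I - v I"
  by (simp add: ideal_congruence)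
lift_definition times_ideal_quotients :: "'a ideal_quotients \<Rightarrow> 'a ideal_quotients \<Rightarrow> 'a ideal_quotients"
  is "\<lambda>u v I. u I * v I"
  by (simp add: ideal_congruence)

instance
proof
  \<comment> \<open>The zero ideal contributes a component in which 0 and 1 differ.\<close>
  have "two_sided_ideal {0 :: 'a}" by (simp add: two_sided_ideal_def)
  then show "(0 :: 'a ideal_quotients) \<noteq> 1"
    by transfer force
qed (transfer, simp add: two_sided_idealD algebra_simps)+

end

lift_definition act :: "'a::ring_1 \<Rightarrow> 'a ideal_quotients \<Rightarrow> 'a ideal_quotients"
  is "\<lambda>c u I. c * u I"
  by (metis right_diff_distrib two_sided_idealD(3))

lift_definition residue :: "'a::ring_1 set \<Rightarrow> 'a \<Rightarrow> 'a ideal_quotients"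
  is "\<lambda>I u J. if J = I then u else 0" .

lemma act_simps:
  "act c (u + v) = act c u + act c v" "act (c + d) u = act c u + act d u"
  "act (c * d) u = act c (act d u)" "act 1 u = u" "act c u * v = act c (u * v)"
  by (transfer, simp add: two_sided_idealD algebra_simps)+

lemma act_central: "(\<And>p. p * c = c * p) \<Longrightarrow> u * act c v = act c (u * v)"
  by transfer (simp add: two_sided_idealD flip: mult.assoc)

lemma residue_eq_iff: "two_sided_ideal I \<Longrightarrow> residue I u = residue I v \<longleftrightarrow> u - v \<in> I"
  by transfer (auto simp: two_sided_idealD)

lemma residue_add: "residue I (u + v) = residue I u + residue I v"
  and residue_diff: "residue I (u - v) = residue I u - residue I v"
  and residue_mult: "residue I (u * v) = residue I u * residue I v"
  and residue_0: "residue I 0 = 0"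
  and residue_act: "residue I (c * u) = act c (residue I u)"
  by (transfer, simp add: two_sided_idealD)+

definition scale_quotients ::
  "'k::field \<Rightarrow> ('g word \<Rightarrow>\<^sub>0 'k) ideal_quotients \<Rightarrow> ('g word \<Rightarrow>\<^sub>0 'k) ideal_quotients" where
  "scale_quotients c u = act (scalar c) u"

interpretation quotients: unital_algebra scale_quotients
  by unfold_locales
    (simp_all add: scale_quotients_def act_simps act_central [OF scalar_central] scalar_add scalar_mult)

lemma residue_scalar: "residue I (scalar c * u) = scale_quotients c (residue I u)"
  by (simp add: scale_quotients_def residue_act)

definition free_residue where "free_residue I \<rho> p = residue I (free_eval \<rho> p)"

lemma free_residue_simps:
  "free_residue I \<rho> (u \<oplus>\<^bsub>FA\<^esub> v) = free_residue I \<rho> u + free_residue I \<rho> v"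
  "free_residue I \<rho> (u \<ominus>\<^bsub>FA\<^esub> v) = free_residue I \<rho> u - free_residue I \<rho> v"
  "free_residue I \<rho> (c \<odot>\<^bsub>FA\<^esub> u) = scale_quotients c (free_residue I \<rho> u)"
  "free_residue I \<rho> \<zero>\<^bsub>FA\<^esub> = 0"
  "free_residue I \<rho> (commutator FA u v) = quotients.cm (free_residue I \<rho> u) (free_residue I \<rho> v)"
  "free_residue I \<rho> (qcommutator FA p u v) = quotients.qc p (free_residue I \<rho> u) (free_residue I \<rho> v)"
  "free_residue I \<rho> (free_gen g) = residue I (\<rho> g)"
  by (simp_all add: free_residue_def free_eval_add free_eval_diff free_eval_mult free_algebra_minus
      commutator_def qcommutator_def residue_add residue_diff residue_0 residue_scalar)
    (simp_all add: residue_mult quotients.cm_def quotients.qc_def)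

lemma free_residue_gen: "free_residue I free_gen p = residue I p"
proof -
  have "free_eval free_gen p = p"
    by (induction p rule: free_algebra_induct) (simp_all add: free_eval_add free_eval_mult)
  then show ?thesis by (simp add: free_residue_def)
qed

lemma residue_gen_relation:
  assumes "(l, r) \<in> R"
  shows "free_residue (relation_ideal R) free_gen l = free_residue (relation_ideal R) free_gen r"
  using relation_in_ideal [OF assms] by (simp add: free_residue_gen residue_eq_iff two_sided_relation_ideal)

section \<open>The isomorphism\<close>

text \<open>Representatives in the free algebra of the named elements of U, since
  \<open>free_eval\<close> takes its values there and not among cosets.\<close>

definition Gt_free :: "nat \<Rightarrow> U_gen word \<Rightarrow>\<^sub>0 'k::field" where
  "Gt_free k = (case k of 0 \<Rightarrow> 1 | Suc k \<Rightarrow> fGt1 k)"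

definition Wm_free :: "'k::field \<Rightarrow> nat \<Rightarrow> U_gen word \<Rightarrow>\<^sub>0 'k" where
  "Wm_free q k = (1 / (q - inverse q)) \<odot>\<^bsub>FA\<^esub> qcommutator FA q (Gt_free k) fW0"

definition Wp_free :: "'k::field \<Rightarrow> nat \<Rightarrow> U_gen word \<Rightarrow>\<^sub>0 'k" where
  "Wp_free q k = (1 / (q - inverse q)) \<odot>\<^bsub>FA\<^esub> qcommutator FA q fW1 (Gt_free k)"

definition G_free :: "'k::field \<Rightarrow> nat \<Rightarrow> U_gen word \<Rightarrow>\<^sub>0 'k" where
  "G_free q k = fGt1 k \<oplus>\<^bsub>FA\<^esub> (1 / (1 - q powi (-2))) \<odot>\<^bsub>FA\<^esub> commutator FA fW1 (Wm_free q k)"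

fun to_U :: "'k::field \<Rightarrow> alt_gen \<Rightarrow> U_gen word \<Rightarrow>\<^sub>0 'k" where
  "to_U q (Alt_Wm k) = Wm_free q k"
| "to_U q (Alt_Wp k) = Wp_free q k"
| "to_U q (Alt_G k) = G_free q k"
| "to_U q (Alt_Gt k) = fGt1 k"

fun from_U :: "U_gen \<Rightarrow> alt_gen word \<Rightarrow>\<^sub>0 'k::field" where
  "from_U U_W0 = aWm 0"
| "from_U U_W1 = aWp 0"
| "from_U (U_Gt k) = aGt1 k"

lemma in_U_eq:
  fixes q :: "'k::field"
  defines "\<pi> \<equiv> \<lambda>x. relation_ideal (U_relations q) +>\<^bsub>free_algebra\<^esub> x"
  shows "Gt_in_U q k = \<pi> (Gt_free k)" "Wm_in_U q k = \<pi> (Wm_free q k)" "Wp_in_U q k = \<pi> (Wp_free q k)"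
    "G_in_U q (Suc k) = \<pi> (G_free q k)"
proof -
  show Gt: "Gt_in_U q k = \<pi> (Gt_free k)" for k
    by (cases k) (simp_all add: Gt_free_def \<pi>_def U_def presented_algebra_coset presented_gen_def)
  show Wm: "Wm_in_U q k = \<pi> (Wm_free q k)"
    by (simp add: Wm_in_U_def Gt Wm_free_def \<pi>_def U_def presented_algebra_coset presented_gen_def
      qcommutator_def free_algebra_minus)
  show "Wp_in_U q k = \<pi> (Wp_free q k)"
    by (simp add: Wp_in_U_def Gt Wp_free_def \<pi>_def U_def presented_algebra_coset presented_gen_def
      qcommutator_def free_algebra_minus)
  show "G_in_U q (Suc k) = \<pi> (G_free q k)"
    unfolding G_in_U.simps Wm Gt
    by (simp add: Gt_free_def G_free_def \<pi>_def U_def presented_algebra_coset presented_gen_def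
      commutator_def free_algebra_minus)
qed

lemma powi_two: "(q :: 'k::field) powi 2 = q * q" "q powi (-2) = inverse q * inverse q"
  by (simp_all add: power_int_def power2_eq_square)

text \<open>\<open>h 0\<close> is the unit of the product ring, while \<open>residue I 1\<close> is
  nonzero in at most one component. Inside a bracket with a residue both act alike.\<close>

lemma free_residue_free:
  fixes I :: "('g word \<Rightarrow>\<^sub>0 'k::field) set" and h :: "nat \<Rightarrow> ('g word \<Rightarrow>\<^sub>0 'k) ideal_quotients"
  assumes h: "h 0 = 1" "\<And>k. free_residue I \<sigma> (fGt1 k) = h (Suc k)"
  shows "free_residue I \<sigma> (Wm_free q k)
      = scale_quotients (1 / (q - inverse q)) (quotients.qc q (h k) (free_residue I \<sigma> fW0))"
    and "free_residue I \<sigma> (Wp_free q k)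
      = scale_quotients (1 / (q - inverse q)) (quotients.qc q (free_residue I \<sigma> fW1) (h k))"
    and "free_residue I \<sigma> (G_free q k) = h (Suc k) + scale_quotients (1 / (1 - inverse q * inverse q))
      (quotients.cm (free_residue I \<sigma> fW1) (free_residue I \<sigma> (Wm_free q k)))"
proof -
  \<comment> \<open>The factor 1 is cancelled in the free algebra before passing to residues,
    because \<open>residue I\<close> does not preserve the unit.\<close>
  have one: "free_residue I \<sigma> (qcommutator FA q 1 u) = quotients.qc q 1 (free_residue I \<sigma> u)"
    "free_residue I \<sigma> (qcommutator FA q u 1) = quotients.qc q (free_residue I \<sigma> u) 1" for u
  proof -
    have "qcommutator FA q 1 u = scalar q * u - scalar (inverse q) * u"
      "qcommutator FA q u 1 = scalar q * u - scalar (inverse q) * u"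
      unfolding qcommutator_def free_algebra_minus free_algebra_simps mult_1_left mult_1_right by (rule refl)+
    then show "free_residue I \<sigma> (qcommutator FA q 1 u) = quotients.qc q 1 (free_residue I \<sigma> u)"
      "free_residue I \<sigma> (qcommutator FA q u 1) = quotients.qc q (free_residue I \<sigma> u) 1"
      unfolding free_residue_def quotients.qc_def
      by (simp_all only: free_eval_diff free_eval_mult free_eval_scalar residue_diff residue_scalar
        mult_1_left mult_1_right)
  qed
  have qcm: "free_residue I \<sigma> (qcommutator FA q (Gt_free k) u) = quotients.qc q (h k) (free_residue I \<sigma> u)"
    "free_residue I \<sigma> (qcommutator FA q u (Gt_free k)) = quotients.qc q (free_residue I \<sigma> u) (h k)" for u
  proof (induction k)
    case 0
    have "Gt_free 0 = (1 :: U_gen word \<Rightarrow>\<^sub>0 'k)" by (simp add: Gt_free_def)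
    then show "free_residue I \<sigma> (qcommutator FA q (Gt_free 0) u) = quotients.qc q (h 0) (free_residue I \<sigma> u)"
      "free_residue I \<sigma> (qcommutator FA q u (Gt_free 0)) = quotients.qc q (free_residue I \<sigma> u) (h 0)"
      by (simp_all only: one h)
  next
    case (Suc k)
    have "Gt_free (Suc k) = (fGt1 k :: U_gen word \<Rightarrow>\<^sub>0 'k)" by (simp add: Gt_free_def)
    then show "free_residue I \<sigma> (qcommutator FA q (Gt_free (Suc k)) u) = quotients.qc q (h (Suc k)) (free_residue I \<sigma> u)"
      "free_residue I \<sigma> (qcommutator FA q u (Gt_free (Suc k))) = quotients.qc q (free_residue I \<sigma> u) (h (Suc k))"
      by (simp_all only: free_residue_simps(6) h)
  qed
  show "free_residue I \<sigma> (Wm_free q k)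
      = scale_quotients (1 / (q - inverse q)) (quotients.qc q (h k) (free_residue I \<sigma> fW0))"
    unfolding Wm_free_def free_residue_simps(3) by (simp only: qcm)
  show "free_residue I \<sigma> (Wp_free q k)
      = scale_quotients (1 / (q - inverse q)) (quotients.qc q (free_residue I \<sigma> fW1) (h k))"
    unfolding Wp_free_def free_residue_simps(3) by (simp only: qcm)
  show "free_residue I \<sigma> (G_free q k) = h (Suc k) + scale_quotients (1 / (1 - inverse q * inverse q))
      (quotients.cm (free_residue I \<sigma> fW1) (free_residue I \<sigma> (Wm_free q k)))"
    unfolding G_free_def free_residue_simps(1,3,5) by (simp add: h powi_two)
qed

lemma U_compact_relations:
  fixes q :: "'k::field"
  assumes q: "q_algebra (scale_quotients :: 'k \<Rightarrow> (U_gen word \<Rightarrow>\<^sub>0 'k) ideal_quotients \<Rightarrow> _) q"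
  defines "\<pi> \<equiv> free_residue (relation_ideal (U_relations q)) free_gen"
  shows "compact_relations scale_quotients q (\<pi> fW0) (\<pi> fW1)
    (\<lambda>k. case k of 0 \<Rightarrow> 1 | Suc k \<Rightarrow> \<pi> (fGt1 k))"
proof -
  interpret q_algebra "scale_quotients :: 'k \<Rightarrow> (U_gen word \<Rightarrow>\<^sub>0 'k) ideal_quotients \<Rightarrow> _" q
    by (rule q)
  have rel: "\<pi> l = \<pi> r" if "(l, r) \<in> U_relations q" for l r
    unfolding \<pi>_def using that by (rule residue_gen_relation)
  note \<pi>_simps = free_residue_simps(3-6) [where I = "relation_ideal (U_relations q)" and \<rho> = free_gen,
      folded \<pi>_def]
  note rels = U_relations.intros [where q = q, THEN rel, unfolded \<pi>_simps powi_two coefficient,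
      folded cc_def]
  show ?thesis
  proof (unfold_locales, goal_cases)
    case 1
    then show ?case by (rule rels(1))
  next
    case 2
    then show ?case by (rule rels(2))
  next
    case 3
    then show ?case by simp
  next
    case (4 i j)
    then show ?case
      using rels(7) by (cases i; cases j) (simp_all add: quotients.cm_def)
  next
    \<comment> \<open>For \<open>k = 0\<close> the inner bracket is W_0 by
      \<open>one_bracket\<close>, which gives relation (iii); a successor gives (v).\<close>
    case (5 k)
    then show ?case
      using rels(3) rels(5) by (cases k) (simp_all add: one_bracket)
  next
    case (6 k)
    then show ?case
      using rels(4) rels(6) by (cases k) (simp_all add: one_bracket)
  qed
qed

text \<open>Modulo the relations of U the images under \<open>to_U\<close> are the alternating
  elements of \<open>compact_relations\<close>, and each defining relation of the extension matches
  lemmas of that locale.\<close>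

lemma to_U_relations:
  fixes q :: "'k::field"
  assumes q: "q_algebra (scale_quotients :: 'k \<Rightarrow> (U_gen word \<Rightarrow>\<^sub>0 'k) ideal_quotients \<Rightarrow> _) q"
  defines "I \<equiv> relation_ideal (U_relations q)"
  shows "(l, r) \<in> Uq_plus_relations q \<Longrightarrow> free_residue I (to_U q) l = free_residue I (to_U q) r"
    and "residue I (Wm_free q 0) = residue I fW0" and "residue I (Wp_free q 0) = residue I fW1"
proof -
  define h where "h k = (case k of 0 \<Rightarrow> 1 | Suc k \<Rightarrow> free_residue I free_gen (fGt1 k))" for k
  interpret C: compact_relations scale_quotients q "free_residue I free_gen fW0" "free_residue I free_gen fW1" h
    using U_compact_relations [OF q] unfolding I_def h_def .
  have h: "h 0 = 1" "free_residue I free_gen (fGt1 k) = h (Suc k)" for k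
    by (simp_all add: h_def)
  have Wm: "residue I (Wm_free q k) = C.Wm k" and Wp: "residue I (Wp_free q k) = C.Wp k"
    and G: "residue I (G_free q k) = C.G k" and Gt: "residue I (fGt1 k) = h (Suc k)" for k
    unfolding free_residue_gen [symmetric] free_residue_free [of h I free_gen, OF h] h(2)
    by (simp_all add: C.a_def C.b_def C.G_def)
  note gen = Wm Wp G Gt and hom = free_residue_simps [where \<rho> = "to_U q"]
  show "residue I (Wm_free q 0) = residue I fW0" "residue I (Wp_free q 0) = residue I fW1"
    unfolding gen C.a_0 C.b_0 C.e_0 C.f_0 by (simp_all add: free_residue_gen)
  show "free_residue I (to_U q) l = free_residue I (to_U q) r" if "(l, r) \<in> Uq_plus_relations q"
    using that
  proof cases
    case (1 k)
    show ?thesis unfolding 1 hom to_U.simps gen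
      using C.x_Wp [of k] by (simp add: C.a_0 C.b_0 C.m_def)
  next
    case (2 k)
    show ?thesis unfolding 2 hom to_U.simps gen powi_two
      using C.m_eq [of k] by (simp add: C.b_0 C.m_def)
  next
    case (3 k)
    show ?thesis unfolding 3 hom to_U.simps gen
      using C.qc_x_G [of k] by (simp add: C.a_0)
  next
    case (4 k)
    show ?thesis unfolding 4 hom to_U.simps gen
      using C.qc_g_x [of "Suc k"] by (simp add: C.a_0)
  next
    case (5 k)
    show ?thesis unfolding 5 hom to_U.simps gen
      using C.qc_G_y [of k] by (simp add: C.b_0)
  next
    case (6 k)
    show ?thesis unfolding 6 hom to_U.simps gen
      using C.qc_y_g [of "Suc k"] by (simp add: C.b_0)
  next
    case (7 k l)
    show ?thesis unfolding 7 hom to_U.simps gen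
      using C.Wm_Wm [of k l] by (simp add: quotients.cm_def)
  next
    case (8 k l)
    show ?thesis unfolding 8 hom to_U.simps gen
      using C.Wp_Wp [of k l] by (simp add: quotients.cm_def)
  next
    case (9 k l)
    show ?thesis unfolding 9 hom to_U.simps gen
      using C.a_b_sym [of 0 k 0 l] by (simp add: quotients.cm_def)
  next
    case (10 k l)
    show ?thesis unfolding 10 hom to_U.simps gen
      using C.Wm_G [of k l] by (simp add: quotients.cm_def)
  next
    case (11 k l)
    show ?thesis unfolding 11 hom to_U.simps gen
      using C.a_g_sym [of 0 k l] by (simp add: quotients.cm_def)
  next
    case (12 k l)
    show ?thesis unfolding 12 hom to_U.simps gen
      using C.Wp_G [of k l] by (simp add: quotients.cm_def)
  next
    case (13 k l)
    show ?thesis unfolding 13 hom to_U.simps gen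
      using C.b_g_sym [of 0 k l] by (simp add: quotients.cm_def)
  next
    case (14 k l)
    show ?thesis unfolding 14 hom to_U.simps gen
      using C.G_G [of k l] by (simp add: quotients.cm_def)
  next
    case (15 k l)
    show ?thesis unfolding 15 hom to_U.simps gen
      using C.g_commute [of "Suc k" "Suc l"] by (simp add: quotients.cm_def)
  next
    case (16 k l)
    show ?thesis unfolding 16 hom to_U.simps gen
      using C.g_G_sym [of k l] by (simp add: quotients.cm_def)
  qed
qed

text \<open>The first claim rests on \<open>compact_from_alternating\<close>. For the second, the
  relations numbered 2, 4 and 6 recover the remaining generators from W_0, W_1 and the G~.\<close>

lemma from_U_relations:
  fixes q :: "'k::field"
  assumes q: "q_algebra (scale_quotients :: 'k \<Rightarrow> (alt_gen word \<Rightarrow>\<^sub>0 'k) ideal_quotients \<Rightarrow> _) q"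
  defines "J \<equiv> relation_ideal (Uq_plus_relations q)"
  shows "(l, r) \<in> U_relations q \<Longrightarrow> free_residue J from_U l = free_residue J from_U r"
    and "free_residue J from_U (to_U q g) = residue J (free_gen g)"
proof -
  interpret q_algebra "scale_quotients :: 'k \<Rightarrow> (alt_gen word \<Rightarrow>\<^sub>0 'k) ideal_quotients \<Rightarrow> _" q
    by (rule q)
  have rel: "free_residue J free_gen l = free_residue J free_gen r" if "(l, r) \<in> Uq_plus_relations q" for l r
    unfolding J_def using that by (rule residue_gen_relation)
  define A where "A k = residue J (aWm k :: alt_gen word \<Rightarrow>\<^sub>0 'k)" for k
  define B where "B k = residue J (aWp k :: alt_gen word \<Rightarrow>\<^sub>0 'k)" for k
  define G where "G k = residue J (aG1 k :: alt_gen word \<Rightarrow>\<^sub>0 'k)" for k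
  define H where "H k = residue J (aGt1 k :: alt_gen word \<Rightarrow>\<^sub>0 'k)" for k
  note defs = A_def [symmetric] B_def [symmetric] G_def [symmetric] H_def [symmetric]
  note rels = Uq_plus_relations.intros [where q = q, THEN rel, unfolded free_residue_simps powi_two defs]
  note compact = compact_from_alternating [of A B _ H G, OF rels(1) rels(2) rels(3) rels(4) rels(5) rels(6) rels(7) rels(8)]
  have gen: "free_residue J from_U fW0 = A 0" "free_residue J from_U fW1 = B 0"
    "free_residue J from_U (fGt1 k) = H k" for k
    by (simp_all add: free_residue_simps defs)
  show "free_residue J from_U l = free_residue J from_U r" if "(l, r) \<in> U_relations q"
    using that
  proof cases
    case 1
    show ?thesis unfolding 1 free_residue_simps(3-6) gen by (rule compact(3))
  next
    case 2
    show ?thesis unfolding 2 free_residue_simps(3-6) gen by (rule compact(4))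
  next
    case 3
    show ?thesis unfolding 3 free_residue_simps(3-6) gen powi_two cc_def [symmetric] by (rule compact(1))
  next
    case 4
    show ?thesis unfolding 4 free_residue_simps(3-6) gen powi_two cc_def [symmetric] by (rule compact(2))
  next
    case (5 k)
    show ?thesis unfolding 5 free_residue_simps(3-6) gen powi_two coefficient rels(4)
      using compact(1) [of "Suc k"] q_units by simp
  next
    case (6 k)
    show ?thesis unfolding 6 free_residue_simps(3-6) gen powi_two coefficient rels(6)
      using compact(2) [of "Suc k"] q_units by simp
  next
    case (7 k l)
    show ?thesis unfolding 7 free_residue_simps(3-6) gen by (rule rels(15))
  qed
  define h where "h k = (case k of 0 \<Rightarrow> 1 | Suc k \<Rightarrow> H k)" for k
  have h: "h 0 = 1" "free_residue J from_U (fGt1 k) = h (Suc k)" for k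
    by (simp_all add: h_def gen)
  note free = free_residue_free [of h J from_U, OF h, of q, unfolded gen]
  have Wm: "free_residue J from_U (Wm_free q k) = A k" for k
    unfolding free using q_units by (cases k) (simp_all add: h_def one_bracket rels(4))
  have Wp: "free_residue J from_U (Wp_free q k) = B k" for k
    unfolding free using q_units by (cases k) (simp_all add: h_def one_bracket rels(6))
  have G: "free_residue J from_U (G_free q k) = G k" for k
  proof -
    have "quotients.cm (B 0) (A k) = - quotients.cm (A k) (B 0)"
      by (simp add: quotients.cm_def)
    then show ?thesis
      unfolding free(3) Wm using minus_P2 by (simp add: h_def rels(2) quotients.scale_right_diff_distrib)
  qed
  show "free_residue J from_U (to_U q g) = residue J (free_gen g)"
    by (cases g) (simp_all add: Wm Wp G gen defs)
qed

theorem corollary6p5: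
  fixes q :: "'k::field"
  assumes q_nonzero: "q \<noteq> 0"
    and q_not_root_of_unity: "\<And>n::nat. n > 0 \<Longrightarrow> q ^ n \<noteq> 1"
  shows "\<exists>\<phi> \<in> algebra_iso (Uq_plus q) (U q). \<forall>k.
    \<phi> (Uq_plus_generator q (Alt_Wm k)) = Wm_in_U q k \<and>
    \<phi> (Uq_plus_generator q (Alt_Wp k)) = Wp_in_U q k \<and>
    \<phi> (Uq_plus_generator q (Alt_G k)) = G_in_U q (Suc k) \<and>
    \<phi> (Uq_plus_generator q (Alt_Gt k)) = Gt_in_U q (Suc k)"
proof -
  have q: "q_algebra (scale_quotients :: 'k \<Rightarrow> (U_gen word \<Rightarrow>\<^sub>0 'k) ideal_quotients \<Rightarrow> _) q"
    and q': "q_algebra (scale_quotients :: 'k \<Rightarrow> (alt_gen word \<Rightarrow>\<^sub>0 'k) ideal_quotients \<Rightarrow> _) q"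
    by (unfold_locales; use assms in auto)+
  have "\<exists>\<phi> \<in> algebra_iso (presented_algebra (Uq_plus_relations q)) (presented_algebra (U_relations q)).
    \<forall>g. \<phi> (presented_gen (Uq_plus_relations q) g) = relation_ideal (U_relations q) +>\<^bsub>free_algebra\<^esub> to_U q g"
  proof (rule presented_algebra_iso [where \<sigma> = from_U])
    show "free_eval (to_U q) l - free_eval (to_U q) r \<in> relation_ideal (U_relations q)"
      if "(l, r) \<in> Uq_plus_relations q" for l r
      using to_U_relations(1) [OF q that] by (simp add: free_residue_def residue_eq_iff two_sided_relation_ideal)
    show "free_eval from_U l - free_eval from_U r \<in> relation_ideal (Uq_plus_relations q)"
      if "(l, r) \<in> U_relations q" for l r
      using from_U_relations(1) [OF q' that] by (simp add: free_residue_def residue_eq_iff two_sided_relation_ideal)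
    show "free_eval from_U (to_U q g) - free_gen g \<in> relation_ideal (Uq_plus_relations q)" for g
      using from_U_relations(2) [OF q', of g] by (simp add: free_residue_def residue_eq_iff two_sided_relation_ideal)
    show "free_eval (to_U q) (from_U g) - free_gen g \<in> relation_ideal (U_relations q)" for g
      using to_U_relations(2,3) [OF q]
      by (cases g) (simp_all add: residue_eq_iff two_sided_relation_ideal two_sided_idealD(1))
  qed
  then obtain \<phi> where "\<phi> \<in> algebra_iso (Uq_plus q) (U q)"
    and "\<phi> (Uq_plus_generator q g) = relation_ideal (U_relations q) +>\<^bsub>free_algebra\<^esub> to_U q g" for g
    unfolding Uq_plus_def U_def by blast
  then show ?thesis
    by (intro bexI [of _ \<phi>]) (simp_all add: in_U_eq Gt_free_def del: G_in_U.simps Gt_in_U.simps)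
qed

end
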